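(* Let $\mathbf u=(\mathbf\Xi,\mathbf V,\mathbf e,\mathbf b)\in\tilde\Omega^{N_p}\times\mathbb R^{3N_p}\times\mathbb R^{3N_1}\times\mathbb R^{3N_2}$ and let $$\mathbb J(\mathbf u)=\begin{pmatrix}0&\mathbb N^\top\mathbb M_m^{-1}&0&0\\ -\mathbb M_m^{-1}\mathbb N&\mathbb M_m^{-1}\mathbb M_q\mathbb N\tilde{\mathbb B}\mathbb N^\top\mathbb M_m^{-1}&\mathbb M_m^{-1}\mathbb M_q\mathbb N\,\mathbb L^1\tilde{\mathsf M}_1^{-1}&0\\ 0&-\tilde{\mathsf M}_1^{-1}(\mathbb L^1)^\top\mathbb N^\top\mathbb M_q\mathbb M_m^{-1}&0&\tilde{\mathsf M}_1^{-1}\mathsf C^\top\\ 0&0&-\mathsf C\tilde{\mathsf M}_1^{-1}&0\end{pmatrix},$$ where $\mathbb N=\mathbb N(\mathbf\Xi)$, $\mathbb L^1=\mathbb L^1(\mathbf\Xi)$, $\tilde{\mathbb B}=\tilde{\mathbb B}(\mathbf\Xi,\mathbf b)$. For smooth real-valued functions $f,g$ of $\mathbf u$ put $\{f,g\}_d=(Df)^\top\,\mathbb J(\mathbf u)\,Dg$, where $D$ denotes the gradient with respect to $\mathbf u$. Then $\{\cdot,\cdot\}_d$ is a (discrete) Poisson bracket: it is bilinear, antisymmetric, satisfies Leibniz' rule, and satisfies the Jacobi identity $$\{\{f,g\}_d,h\}_d+\{\{g,h\}_d,f\}_d+\{\{h,f\}_d,g\}_d=0$$ for all smooth $f,g,h$,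 at all states $\mathbf u$ satisfying the discrete magnetic Gauss law $\mathsf D\mathbf b=0$.
   Context: Geometry: $\tilde\Omega=[0,1]^3$ and $F:\tilde\Omega\to\Omega\subset\mathbb R^3$ is a smooth bijection with Jacobi matrix $DF(\xi)$ and Jacobian $J_F(\xi)=\det DF(\xi)\neq0$ for all $\xi\in\tilde\Omega$. Put $N(\xi)=DF(\xi)^{-\top}$ and $G_n=N^\top N$. Discrete de Rham sequence on $\tilde\Omega$: there are linearly independent families of basis functions, collected in rows: $\tilde\Lambda^0(\xi)\in\mathbb R^{1\times N_0}$, $\tilde{\mathbf\Lambda}^1(\xi)\in\mathbb R^{3\times3N_1}$, $\tilde{\mathbf\Lambda}^2(\xi)\in\mathbb R^{3\times3N_2}$, $\tilde\Lambda^3(\xi)\in\mathbb R^{1\times N_3}$ (the columns of $\tilde{\mathbf\Lambda}^k$, $k=1,2$, are vector-valued basis functions, each having a single nonzero component), and constant matrices $\mathsf G\in\mathbb R^{3N_1\times N_0}$, $\mathsf C\in\mathbb R^{3N_2\times3N_1}$, $\mathsf D\in\mathbb R^{N_3\times3N_2}$ such that (operators applied columnwise) $\nabla\tilde\Lambda^0=\tilde{\mathbf\Lambda}^1\mathsf G$, $\nabla\times\tilde{\mathbf\Lambda}^1=\tilde{\mathbf\Lambda}^2\mathsf C$, $\nabla\cdot\tilde{\mathbf\Lambda}^2=\tilde\Lambda^3\mathsf D$, with $\mathsf D\mathsf C=0$ and $\mathsf C\mathsf G=0$. All basis functions are assumed smooth enough that the derivatives appearing exist classically. The mass matrix $\tilde{\mathsf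 M}_1=\int_{\tilde\Omega}(\tilde{\mathbf\Lambda}^1)^\top G_n\tilde{\mathbf\Lambda}^1|J_F|\,d\xi$ is symmetric positive definite. Particles: $N_p$ particles have logical positions $\xi_p\in\tilde\Omega$, velocities $v_p\in\mathbb R^3$, constant weights $\omega_p>0$, masses $m_p>0$ and charges $q_p\neq0$. $\mathbf\Xi=(\xi_1,\dots,\xi_{N_p})$, $\mathbf V=(v_1,\dots,v_{N_p})$. $\mathbb M_m=\mathrm{diag}(\omega_pm_p)\otimes\mathbb I_3$, $\mathbb M_q=\mathrm{diag}(\omega_pq_p)\otimes\mathbb I_3$. $\mathbb N(\mathbf\Xi)$ is the block-diagonal $3N_p\times3N_p$ matrix with blocks $N(\xi_p)$. $\mathbb L^1(\mathbf\Xi)$ is the $3N_p\times3N_1$ matrix obtained by stacking the blocks $\tilde{\mathbf\Lambda}^1(\xi_p)$, $p=1,\dots,N_p$. $\tilde{\mathbb B}(\mathbf\Xi,\mathbf b)$ is the block-diagonal $3N_p\times3N_p$ matrix whose $p$-th block is $$\begin{pmatrix}0&\beta_3&-\beta_2\\-\beta_3&0&\beta_1\\ \beta_2&-\beta_1&0\end{pmatrix},\qquad (\beta_1,\beta_2,\beta_3)^\top=\tilde{\mathbf\Lambda}^2(\xi_p)\,\mathbf b,$$ i.e. the matrix of $w\mapsto w\times\tilde{\mathbf\Lambda}^2(\xi_p)\mathbf b$. *)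

theory Defs
  imports "HOL-Analysis.Analysis"
begin

section \<open>Calculus on sets with boundary\<close>

text \<open>
  \<open>C_k_open k T f\<close> is the usual notion of \<open>f\<close> being \<open>k\<close> times continuously differentiable
  on an \<^emph>\<open>open\<close> set \<open>T\<close>. The cube and the state space below are closed, so smoothness on a
  general set means that \<open>f\<close> agrees there with a smooth function on an open neighbourhood.
\<close>

primrec C_k_open ::
    "nat \<Rightarrow> 'a::real_normed_vector set \<Rightarrow> ('a \<Rightarrow> 'b::real_normed_vector) \<Rightarrow> bool" where
  "C_k_open 0 T f \<longleftrightarrow> continuous_on T f"
| "C_k_open (Suc k) T f \<longleftrightarrow>
     f differentiable_on T \<and> (\<forall>v. C_k_open k T (\<lambda>x. frechet_derivative f (at x) v))"

definition smooth_on ::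
    "'a::real_normed_vector set \<Rightarrow> ('a \<Rightarrow> 'b::real_normed_vector) \<Rightarrow> bool" where
  "smooth_on S f \<longleftrightarrow>
     (\<exists>T g. open T \<and> S \<subseteq> T \<and> (\<forall>x\<in>S. g x = f x) \<and> (\<forall>k. C_k_open k T g))"

text \<open>
  All derivatives are taken within the domain \<open>S\<close>. The domains used are convex with nonempty
  interior, so these derivatives are unique, also at boundary points, and depend only on the
  values on \<open>S\<close>.
\<close>

definition partial_deriv :: "(real^'n) set \<Rightarrow> 'n \<Rightarrow> (real^'n \<Rightarrow> real) \<Rightarrow> real^'n \<Rightarrow> real" where
  "partial_deriv S i f x = frechet_derivative f (at x within S) (axis i 1)"

definition gradient :: "(real^'n) set \<Rightarrow> (real^'n \<Rightarrow> real) \<Rightarrow> real^'n \<Rightarrow> real^'n" where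
  "gradient S f x = (\<chi> i. partial_deriv S i f x)"

definition curl :: "(real^3) set \<Rightarrow> (real^3 \<Rightarrow> real^3) \<Rightarrow> real^3 \<Rightarrow> real^3" where
  "curl S A x = vector
     [partial_deriv S 2 (\<lambda>y. A y $ 3) x - partial_deriv S 3 (\<lambda>y. A y $ 2) x,
      partial_deriv S 3 (\<lambda>y. A y $ 1) x - partial_deriv S 1 (\<lambda>y. A y $ 3) x,
      partial_deriv S 1 (\<lambda>y. A y $ 2) x - partial_deriv S 2 (\<lambda>y. A y $ 1) x]"

definition divergence :: "(real^3) set \<Rightarrow> (real^3 \<Rightarrow> real^3) \<Rightarrow> real^3 \<Rightarrow> real" where
  "divergence S A x = (\<Sum>i\<in>UNIV. partial_deriv S i (\<lambda>y. A y $ i) x)"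


section \<open>Matrices\<close>

definition symmetric_positive_definite :: "real^'n^'n \<Rightarrow> bool" where
  "symmetric_positive_definite A \<longleftrightarrow> transpose A = A \<and> (\<forall>x. x \<noteq> 0 \<longrightarrow> x \<bullet> (A *v x) > 0)"

definition diag :: "('n \<Rightarrow> real) \<Rightarrow> real^'n^'n" where
  "diag d = (\<chi> i j. if i = j then d i else 0)"

definition kronecker :: "real^'b^'a \<Rightarrow> real^'d^'c \<Rightarrow> real^('b \<times> 'd)^('a \<times> 'c)" where
  "kronecker A B = (\<chi> i j. A $ fst i $ fst j * B $ snd i $ snd j)"

definition block_diag :: "('p::finite \<Rightarrow> real^'b^'a) \<Rightarrow> real^('p \<times> 'b)^('p \<times> 'a)" where
  "block_diag A = (\<chi> i j. if fst i = fst j then A (fst i) $ snd i $ snd j else 0)"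

definition block_stack :: "('p::finite \<Rightarrow> real^'n^'a) \<Rightarrow> real^'n^('p \<times> 'a)" where
  "block_stack A = (\<chi> i j. A (fst i) $ snd i $ j)"

definition block_row4 ::
    "real^'a^'r \<Rightarrow> real^'b^'r \<Rightarrow> real^'c^'r \<Rightarrow> real^'d^'r \<Rightarrow> real^('a + 'b + 'c + 'd)^'r" where
  "block_row4 A B C D = (\<chi> i j. case j of
      Inl a \<Rightarrow> A $ i $ a
    | Inr (Inl b) \<Rightarrow> B $ i $ b
    | Inr (Inr (Inl c)) \<Rightarrow> C $ i $ c
    | Inr (Inr (Inr d)) \<Rightarrow> D $ i $ d)"

definition block_col4 ::
    "real^'n^'a \<Rightarrow> real^'n^'b \<Rightarrow> real^'n^'c \<Rightarrow> real^'n^'d \<Rightarrow> real^'n^('a + 'b + 'c + 'd)" where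
  "block_col4 A B C D = (\<chi> i. case i of
      Inl a \<Rightarrow> A $ a
    | Inr (Inl b) \<Rightarrow> B $ b
    | Inr (Inr (Inl c)) \<Rightarrow> C $ c
    | Inr (Inr (Inr d)) \<Rightarrow> D $ d)"


section \<open>Geometry\<close>

abbreviation cube :: "(real^3) set" where
  "cube \<equiv> cbox 0 1"

definition DF :: "(real^3 \<Rightarrow> real^3) \<Rightarrow> real^3 \<Rightarrow> real^3^3" where
  "DF F \<xi> = jacobian F (at \<xi> within cube)"

definition J_F :: "(real^3 \<Rightarrow> real^3) \<Rightarrow> real^3 \<Rightarrow> real" where
  "J_F F \<xi> = det (DF F \<xi>)"

definition N_F :: "(real^3 \<Rightarrow> real^3) \<Rightarrow> real^3 \<Rightarrow> real^3^3" where
  "N_F F \<xi> = transpose (matrix_inv (DF F \<xi>))"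

definition G_n :: "(real^3 \<Rightarrow> real^3) \<Rightarrow> real^3 \<Rightarrow> real^3^3" where
  "G_n F \<xi> = transpose (N_F F \<xi>) ** N_F F \<xi>"


section \<open>Discrete de Rham sequence\<close>

text \<open>
  A family of basis functions is the matrix-valued function whose columns are its members; it has
  one row for scalar and three rows for vector-valued families. A family with \<open>3 N\<^sub>k\<close> members
  is indexed by \<open>'n \<times> 3\<close>.
\<close>

definition linearly_independent_family :: "(real^3 \<Rightarrow> real^'j^'r) \<Rightarrow> bool" where
  "linearly_independent_family \<Lambda> \<longleftrightarrow> (\<forall>c. (\<forall>\<xi>\<in>cube. \<Lambda> \<xi> *v c = 0) \<longrightarrow> c = 0)"

text \<open>
  That the remaining component is not identically zero follows from linear independence.
\<close>

definition single_component_columns :: "(real^3 \<Rightarrow> real^'j^3) \<Rightarrow> bool" where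
  "single_component_columns \<Lambda> \<longleftrightarrow> (\<forall>j. \<exists>k. \<forall>\<xi>\<in>cube. \<forall>i. i \<noteq> k \<longrightarrow> \<Lambda> \<xi> $ i $ j = 0)"

definition discrete_de_Rham ::
    "(real^3 \<Rightarrow> real^'n0^1) \<Rightarrow> (real^3 \<Rightarrow> real^('n1::finite \<times> 3)^3) \<Rightarrow>
     (real^3 \<Rightarrow> real^('n2::finite \<times> 3)^3) \<Rightarrow> (real^3 \<Rightarrow> real^'n3^1) \<Rightarrow>
     real^'n0^('n1 \<times> 3) \<Rightarrow> real^('n1 \<times> 3)^('n2 \<times> 3) \<Rightarrow> real^('n2 \<times> 3)^'n3 \<Rightarrow> bool" where
  "discrete_de_Rham \<Lambda>0 \<Lambda>1 \<Lambda>2 \<Lambda>3 G C D \<longleftrightarrow>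
     linearly_independent_family \<Lambda>0 \<and> linearly_independent_family \<Lambda>1 \<and>
     linearly_independent_family \<Lambda>2 \<and> linearly_independent_family \<Lambda>3 \<and>
     single_component_columns \<Lambda>1 \<and> single_component_columns \<Lambda>2 \<and>
     \<Lambda>0 differentiable_on cube \<and> \<Lambda>1 differentiable_on cube \<and> \<Lambda>2 differentiable_on cube \<and>
     (\<forall>\<xi>\<in>cube. \<forall>j. gradient cube (\<lambda>\<eta>. \<Lambda>0 \<eta> $ 1 $ j) \<xi> = column j (\<Lambda>1 \<xi> ** G)) \<and>
     (\<forall>\<xi>\<in>cube. \<forall>j. curl cube (\<lambda>\<eta>. column j (\<Lambda>1 \<eta>)) \<xi> = column j (\<Lambda>2 \<xi> ** C)) \<and>
     (\<forall>\<xi>\<in>cube. \<forall>j. divergence cube (\<lambda>\<eta>. column j (\<Lambda>2 \<eta>)) \<xi> = (\<Lambda>3 \<xi> ** D) $ 1 $ j) \<and>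
     D ** C = 0 \<and> C ** G = 0"

definition mass_1 :: "(real^3 \<Rightarrow> real^3) \<Rightarrow> (real^3 \<Rightarrow> real^('n1::finite \<times> 3)^3) \<Rightarrow>
    real^('n1 \<times> 3)^('n1 \<times> 3)" where
  "mass_1 F \<Lambda>1 = integral cube
     (\<lambda>\<xi>. \<bar>J_F F \<xi>\<bar> *\<^sub>R (transpose (\<Lambda>1 \<xi>) ** G_n F \<xi> ** \<Lambda>1 \<xi>))"


section \<open>States and particle matrices\<close>

text \<open>
  A state \<open>u = (\<Xi>, V, e, b)\<close> is one vector, whose index type is the sum of the four index types,
  so that the four blocks are selected by \<open>Inl\<close>, \<open>Inr \<circ> Inl\<close>, and so on.
\<close>

type_synonym ('p, 'n1, 'n2) state = "real^('p \<times> 3 + 'p \<times> 3 + 'n1 \<times> 3 + 'n2 \<times> 3)"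

definition position :: "('p::finite, 'n1::finite, 'n2::finite) state \<Rightarrow> 'p \<Rightarrow> real^3" where
  "position u p = (\<chi> k. u $ Inl (p, k))"

definition b_coeff :: "('p::finite, 'n1::finite, 'n2::finite) state \<Rightarrow> real^('n2 \<times> 3)" where
  "b_coeff u = (\<chi> j. u $ Inr (Inr (Inr j)))"

definition state_space :: "('p::finite, 'n1::finite, 'n2::finite) state set" where
  "state_space = {u. \<forall>p. position u p \<in> cube}"

text \<open>The matrix of \<open>w \<mapsto> w \<times> \<beta>\<close>.\<close>

definition rot_matrix :: "real^3 \<Rightarrow> real^3^3" where
  "rot_matrix \<beta> = vector
     [vector [0, \<beta> $ 3, - \<beta> $ 2],
      vector [- \<beta> $ 3, 0, \<beta> $ 1],
      vector [\<beta> $ 2, - \<beta> $ 1, 0]]"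

definition particle_diag :: "('p::finite \<Rightarrow> real) \<Rightarrow> real^('p \<times> 3)^('p \<times> 3)" where
  "particle_diag d = kronecker (diag d) (mat 1)"

definition N_particles :: "(real^3 \<Rightarrow> real^3) \<Rightarrow> ('p::finite, 'n1::finite, 'n2::finite) state \<Rightarrow>
    real^('p \<times> 3)^('p \<times> 3)" where
  "N_particles F u = block_diag (\<lambda>p. N_F F (position u p))"

definition L1_particles ::
    "(real^3 \<Rightarrow> real^('n1 \<times> 3)^3) \<Rightarrow> ('p::finite, 'n1::finite, 'n2::finite) state \<Rightarrow>
     real^('n1 \<times> 3)^('p \<times> 3)" where
  "L1_particles \<Lambda>1 u = block_stack (\<lambda>p. \<Lambda>1 (position u p))"

definition B_particles ::
    "(real^3 \<Rightarrow> real^('n2 \<times> 3)^3) \<Rightarrow> ('p::finite, 'n1::finite, 'n2::finite) state \<Rightarrow>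
     real^('p \<times> 3)^('p \<times> 3)" where
  "B_particles \<Lambda>2 u = block_diag (\<lambda>p. rot_matrix (\<Lambda>2 (position u p) *v b_coeff u))"


section \<open>The bracket\<close>

definition poisson_matrix ::
    "(real^3 \<Rightarrow> real^3) \<Rightarrow> (real^3 \<Rightarrow> real^('n1 \<times> 3)^3) \<Rightarrow> (real^3 \<Rightarrow> real^('n2 \<times> 3)^3) \<Rightarrow>
     real^('n1 \<times> 3)^('n2 \<times> 3) \<Rightarrow> ('p \<Rightarrow> real) \<Rightarrow> ('p \<Rightarrow> real) \<Rightarrow> ('p \<Rightarrow> real) \<Rightarrow>
     ('p::finite, 'n1::finite, 'n2::finite) state \<Rightarrow>
     real^('p \<times> 3 + 'p \<times> 3 + 'n1 \<times> 3 + 'n2 \<times> 3)^('p \<times> 3 + 'p \<times> 3 + 'n1 \<times> 3 + 'n2 \<times> 3)" where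
  "poisson_matrix F \<Lambda>1 \<Lambda>2 C \<omega> m q u =
     (let Mm' = matrix_inv (particle_diag (\<lambda>p. \<omega> p * m p));
          Mq = particle_diag (\<lambda>p. \<omega> p * q p);
          M1' = matrix_inv (mass_1 F \<Lambda>1);
          N = N_particles F u;
          L = L1_particles \<Lambda>1 u;
          B = B_particles \<Lambda>2 u
      in block_col4
        (block_row4 0 (transpose N ** Mm') 0 0)
        (block_row4 (- (Mm' ** N)) (Mm' ** Mq ** N ** B ** transpose N ** Mm')
                    (Mm' ** Mq ** N ** L ** M1') 0)
        (block_row4 0 (- (M1' ** transpose L ** transpose N ** Mq ** Mm')) 0
                    (M1' ** transpose C))
        (block_row4 0 0 (- (C ** M1')) 0))"

definition bracket ::
    "(real^3 \<Rightarrow> real^3) \<Rightarrow> (real^3 \<Rightarrow> real^('n1 \<times> 3)^3) \<Rightarrow> (real^3 \<Rightarrow> real^('n2 \<times> 3)^3) \<Rightarrow>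
     real^('n1 \<times> 3)^('n2 \<times> 3) \<Rightarrow> ('p \<Rightarrow> real) \<Rightarrow> ('p \<Rightarrow> real) \<Rightarrow> ('p \<Rightarrow> real) \<Rightarrow>
     (('p::finite, 'n1::finite, 'n2::finite) state \<Rightarrow> real) \<Rightarrow> (('p, 'n1, 'n2) state \<Rightarrow> real) \<Rightarrow>
     ('p, 'n1, 'n2) state \<Rightarrow> real" where
  "bracket F \<Lambda>1 \<Lambda>2 C \<omega> m q f g u =
     gradient state_space f u \<bullet> (poisson_matrix F \<Lambda>1 \<Lambda>2 C \<omega> m q u *v gradient state_space g u)"

text \<open>
  Bilinearity, antisymmetry and Leibniz' rule are required at every state, the Jacobi identity
  at the states in \<open>A\<close>; the inner brackets are functions on all of \<open>S\<close>.
\<close>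

definition poisson_bracket_on ::
    "'a::real_normed_vector set \<Rightarrow> 'a set \<Rightarrow>
     (('a \<Rightarrow> real) \<Rightarrow> ('a \<Rightarrow> real) \<Rightarrow> 'a \<Rightarrow> real) \<Rightarrow> bool" where
  "poisson_bracket_on S A br \<longleftrightarrow>
     (\<forall>f g h. smooth_on S f \<longrightarrow> smooth_on S g \<longrightarrow> smooth_on S h \<longrightarrow>
       (\<forall>u\<in>S. \<forall>\<alpha> \<beta>.
          br (\<lambda>x. \<alpha> * f x + \<beta> * g x) h u = \<alpha> * br f h u + \<beta> * br g h u \<and>
          br h (\<lambda>x. \<alpha> * f x + \<beta> * g x) u = \<alpha> * br h f u + \<beta> * br h g u) \<and>
       (\<forall>u\<in>S. br f g u = - br g f u) \<and>
       (\<forall>u\<in>S. br (\<lambda>x. f x * g x) h u = f u * br g h u + br f h u * g u \<and>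
               br h (\<lambda>x. f x * g x) u = f u * br h g u + br h f u * g u) \<and>
       (\<forall>u\<in>S \<inter> A. br (br f g) h u + br (br g h) f u + br (br h f) g u = 0))"

end

theory Submission
  imports Defs
begin

text \<open>
  Per particle, replace the velocity \<open>v\<close> by the canonical momentum
  \<open>\<pi> = \<omega> m DF(\<xi>)\<^sup>T v\<close>. In the variables \<open>(\<xi>, \<pi>, e, b)\<close> the map \<open>F\<close> survives only in the constant \<open>M\<^sub>1\<close>:
  \<open>{\<xi>\<^sub>i, \<pi>\<^sub>j} = \<delta>\<^sub>i\<^sub>j\<close>, \<open>{\<pi>\<^sub>i, \<pi>\<^sub>j} = \<omega> q \<epsilon>\<^sub>i\<^sub>j\<^sub>k (\<Lambda>2 b)\<^sub>k\<close>, \<open>{\<pi>, e} = \<omega> q \<Lambda>1 M\<^sub>1\<inverse>\<close>,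
  \<open>{e, b} = M\<^sub>1\<inverse> C\<^sup>T\<close>, and all others vanish. These brackets depend on \<open>\<xi>\<close> and \<open>b\<close> only, so just two
  kinds of triples have a nontrivial Jacobi sum. For \<open>(\<pi>, \<pi>, \<pi>)\<close> it is a multiple of
  \<open>div (\<Lambda>2 b) = \<Lambda>3 D b\<close>, which is zero by the discrete Gauss law. For \<open>(\<pi>, \<pi>, e)\<close> it is the
  difference between \<open>curl \<Lambda>1\<close> and \<open>\<Lambda>2 C\<close>, which is zero by the commuting diagram.

  The change of variables is never carried out on functions. For an antisymmetric differentiable
  matrix \<open>J\<close>, the second derivatives of the arguments cancel in the cyclic sum, so that the sum at a
  state depends on the three gradients there and on nothing else (\<open>jacobiator_tensorial\<close>). The
  functions \<open>generator x y s t\<close>, which are the linear combinations of \<open>\<xi>, \<pi>, e, b\<close> with constant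
  coefficients, attain every gradient at a given state (\<open>gradient_is_generator_gradient\<close>), and for
  them the two identities above give the result (\<open>jacobi_generators\<close>). Antisymmetry is read off from
  the bilinear form of \<open>J\<close> in the canonical variables (\<open>poisson_form\<close>), and bilinearity and Leibniz'
  rule are those of the gradient.

  The state space has a boundary, so derivatives are taken within it. They are unique because one
  can move along every axis without leaving the set, and the second derivatives are symmetric
  because the functions extend smoothly to a neighbourhood.
\<close>

section \<open>Symmetry of second derivatives\<close>

text \<open>
  Schwarz's theorem in the form that asks for differentiability of the first derivatives at the one
  point \<open>x\<close>. The mean value theorem in the direction \<open>v\<close> turns the second difference into \<open>h\<close> times
  an increment of \<open>f' _ v\<close> along \<open>h w\<close>, which is \<open>h A w\<close> up to \<open>o(h)\<close>. The second difference is
  symmetric in \<open>v\<close> and \<open>w\<close>, and hence so is its limit.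
\<close>

lemma second_difference_quotient_tendsto:
  fixes f :: "'a::real_normed_vector \<Rightarrow> real"
  assumes "open T" "x \<in> T"
    and der: "\<And>y. y \<in> T \<Longrightarrow> (f has_derivative f' y) (at y)"
    and der2: "((\<lambda>y. f' y v) has_derivative A) (at x)"
  shows "((\<lambda>h. (f (x + h *\<^sub>R v + h *\<^sub>R w) - f (x + h *\<^sub>R v) - f (x + h *\<^sub>R w) + f x) / h\<^sup>2)
           \<longlongrightarrow> A w) (at_right 0)"
proof (rule tendstoI)
  fix e :: real assume "e > 0"
  \<comment> \<open>In units of \<open>h\<close>, a bound for the total length of the two displacements at which the linear approximation is used.\<close>
  define K where "K = 2 * norm v + norm w + 1"
  have K: "K > 0" by (simp add: K_def add_nonneg_pos)
  interpret A: bounded_linear A using der2 by (rule has_derivative_bounded_linear)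
  obtain d1 where d1: "d1 > 0" "ball x d1 \<subseteq> T"
    using \<open>open T\<close> \<open>x \<in> T\<close> open_contains_ball by blast
  \<comment> \<open>Linear approximation with half of the tolerance, so that the final estimate is strict.\<close>
  have "e / (2 * K) > 0" using \<open>e > 0\<close> K by simp
  then obtain d2 where d2: "d2 > 0" and
    appr: "\<And>y. norm (y - x) < d2 \<Longrightarrow> norm (f' y v - f' x v - A (y - x)) \<le> e / (2 * K) * norm (y - x)"
    using der2 unfolding has_derivative_at_alt by blast
  define d where "d = min d1 d2 / K"
  have "d > 0" using d1 d2 K by (simp add: d_def)
  have *: "dist ((f (x + h *\<^sub>R v + h *\<^sub>R w) - f (x + h *\<^sub>R v) - f (x + h *\<^sub>R w) + f x) / h\<^sup>2) (A w) < e"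
    if h: "0 < h" "h < d" for h
  proof -
    have hK: "h * K < d1" "h * K < d2" using h K by (auto simp: d_def field_simps)
    have n1: "norm (s *\<^sub>R v + t *\<^sub>R w) \<le> h * (norm v + norm w)"
      if "0 \<le> s" "s \<le> h" "0 \<le> t" "t \<le> h" for s t
    proof -
      have "norm (s *\<^sub>R v + t *\<^sub>R w) \<le> s * norm v + t * norm w"
        using that by (metis abs_of_nonneg norm_scaleR norm_triangle_ineq)
      also have "\<dots> \<le> h * norm v + h * norm w"
        using that by (intro add_mono mult_right_mono) auto
      finally show ?thesis by (simp add: algebra_simps)
    qed
    have "h * (norm v + norm w) < h * K" using h by (simp add: K_def add_strict_increasing2)
    then have n2: "norm (s *\<^sub>R v + t *\<^sub>R w) < d1 \<and> norm (s *\<^sub>R v + t *\<^sub>R w) < d2"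
      if "0 \<le> s" "s \<le> h" "0 \<le> t" "t \<le> h" for s t
      using n1[OF that] hK by linarith
    have inT: "x + s *\<^sub>R v + t *\<^sub>R w \<in> T" if "0 \<le> s" "s \<le> h" "0 \<le> t" "t \<le> h" for s t
    proof -
      have "dist x (x + s *\<^sub>R v + t *\<^sub>R w) = norm (s *\<^sub>R v + t *\<^sub>R w)"
        by (simp add: dist_norm norm_minus_commute add.assoc add.commute)
      then show ?thesis using n2[OF that] d1 by (auto simp: subset_iff)
    qed
    define \<phi> where "\<phi> = (\<lambda>s. f (x + s *\<^sub>R v + h *\<^sub>R w) - f (x + s *\<^sub>R v))"
    have der\<phi>: "(\<phi> has_real_derivative (f' (x + s *\<^sub>R v + h *\<^sub>R w) v - f' (x + s *\<^sub>R v) v)) (at s)"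
      if "0 \<le> s" "s \<le> h" for s
    proof -
      have line: "((\<lambda>s. f (x + s *\<^sub>R v + t *\<^sub>R w)) has_derivative (\<lambda>r. r * f' (x + s *\<^sub>R v + t *\<^sub>R w) v)) (at s)"
        if "0 \<le> t" "t \<le> h" for t
      proof -
        have 1: "(f has_derivative f' (x + s *\<^sub>R v + t *\<^sub>R w)) (at (x + s *\<^sub>R v + t *\<^sub>R w))"
          using der inT that \<open>0 \<le> s\<close> \<open>s \<le> h\<close> by blast
        interpret f': bounded_linear "f' (x + s *\<^sub>R v + t *\<^sub>R w)"
          using 1 by (rule has_derivative_bounded_linear)
        have "((\<lambda>s. x + s *\<^sub>R v + t *\<^sub>R w) has_derivative (\<lambda>r. r *\<^sub>R v)) (at s)"
          by (auto intro!: derivative_eq_intros)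
        from has_derivative_compose[OF this 1] show ?thesis by (simp add: f'.scaleR)
      qed
      have "(\<phi> has_derivative
          (\<lambda>r. r * f' (x + s *\<^sub>R v + h *\<^sub>R w) v - r * f' (x + s *\<^sub>R v) v)) (at s)"
        using has_derivative_diff[OF line[of h] line[of 0]] h(1) unfolding \<phi>_def by simp
      moreover have "(\<lambda>r. r * f' (x + s *\<^sub>R v + h *\<^sub>R w) v - r * f' (x + s *\<^sub>R v) v)
          = (*) (f' (x + s *\<^sub>R v + h *\<^sub>R w) v - f' (x + s *\<^sub>R v) v)"
        by (simp add: fun_eq_iff right_diff_distrib mult.commute)
      ultimately show ?thesis unfolding has_field_derivative_def by simp
    qed
    obtain \<theta> where \<theta>: "0 < \<theta>" "\<theta> < h"
      "\<phi> h - \<phi> 0 = (h - 0) * (f' (x + \<theta> *\<^sub>R v + h *\<^sub>R w) v - f' (x + \<theta> *\<^sub>R v) v)"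
      using MVT2[OF h(1), of \<phi> "\<lambda>s. f' (x + s *\<^sub>R v + h *\<^sub>R w) v - f' (x + s *\<^sub>R v) v"] der\<phi> by blast
    let ?D = "f' (x + \<theta> *\<^sub>R v + h *\<^sub>R w) v - f' (x + \<theta> *\<^sub>R v) v"
    have q: "(f (x + h *\<^sub>R v + h *\<^sub>R w) - f (x + h *\<^sub>R v) - f (x + h *\<^sub>R w) + f x) / h\<^sup>2 = ?D / h"
    proof -
      have "f (x + h *\<^sub>R v + h *\<^sub>R w) - f (x + h *\<^sub>R v) - f (x + h *\<^sub>R w) + f x = \<phi> h - \<phi> 0"
        by (simp add: \<phi>_def)
      also have "\<dots> = h * ?D" by (rule \<theta>(3)[unfolded diff_zero])
      finally have "f (x + h *\<^sub>R v + h *\<^sub>R w) - f (x + h *\<^sub>R v) - f (x + h *\<^sub>R w) + f x = h * ?D" .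
      from arg_cong[OF this, of "\<lambda>t. t / h\<^sup>2"] show ?thesis
        unfolding power2_eq_square using h(1) by (simp only: mult_divide_mult_cancel_left less_imp_neq not_sym if_False)
    qed
    have a1: "norm (f' (x + \<theta> *\<^sub>R v + h *\<^sub>R w) v - f' x v - A (\<theta> *\<^sub>R v + h *\<^sub>R w))
        \<le> e / (2 * K) * norm (\<theta> *\<^sub>R v + h *\<^sub>R w)"
      using appr[of "x + \<theta> *\<^sub>R v + h *\<^sub>R w"] n2[of \<theta> h] \<theta> h by (simp add: add.assoc)
    have a2: "norm (f' (x + \<theta> *\<^sub>R v) v - f' x v - A (\<theta> *\<^sub>R v)) \<le> e / (2 * K) * norm (\<theta> *\<^sub>R v)"
      using appr[of "x + \<theta> *\<^sub>R v"] n2[of \<theta> 0] \<theta> h by simp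
    have "\<bar>?D - h * A w\<bar> \<le> e / (2 * K) * (norm (\<theta> *\<^sub>R v + h *\<^sub>R w) + norm (\<theta> *\<^sub>R v))"
      using a1 a2 by (simp add: A.add A.scaleR algebra_simps)
    also have "\<dots> \<le> e / (2 * K) * (h * K)"
    proof (rule mult_left_mono)
      have "norm (\<theta> *\<^sub>R v) \<le> h * norm v" using \<theta> by (simp add: mult_right_mono)
      moreover have "h * K = h * (norm v + norm w) + h * norm v + h" by (simp add: K_def algebra_simps)
      ultimately show "norm (\<theta> *\<^sub>R v + h *\<^sub>R w) + norm (\<theta> *\<^sub>R v) \<le> h * K"
        using n1[of \<theta> h] \<theta> h by simp
    qed (use \<open>e > 0\<close> K in simp)
    also have "\<dots> = h * (e / 2)" using K by simp
    also have "\<dots> < h * e" using h \<open>e > 0\<close> by simp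
    finally have "\<bar>?D - h * A w\<bar> < h * e" .
    then have "\<bar>(?D - h * A w) / h\<bar> < e" using h(1) by (simp add: abs_divide pos_divide_less_eq mult.commute)
    then show ?thesis using h unfolding q dist_real_def by (simp only: diff_divide_distrib) simp
  qed
  show "\<forall>\<^sub>F h in at_right 0. dist ((f (x + h *\<^sub>R v + h *\<^sub>R w) - f (x + h *\<^sub>R v) - f (x + h *\<^sub>R w) + f x) / h\<^sup>2) (A w) < e"
    using \<open>d > 0\<close> * by (auto simp: eventually_at_right_field)
qed

lemma second_derivative_symmetric_real:
  fixes f :: "'a::real_normed_vector \<Rightarrow> real"
  assumes "open T" "x \<in> T"
    and "\<And>y. y \<in> T \<Longrightarrow> (f has_derivative f' y) (at y)"
    and "((\<lambda>y. f' y v) has_derivative A) (at x)"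
    and "((\<lambda>y. f' y w) has_derivative B) (at x)"
  shows "A w = B v"
proof -
  let ?\<Delta> = "\<lambda>v w h. (f (x + h *\<^sub>R v + h *\<^sub>R w) - f (x + h *\<^sub>R v) - f (x + h *\<^sub>R w) + f x) / h\<^sup>2"
  have "?\<Delta> w v = ?\<Delta> v w" by (simp add: algebra_simps)
  then have "(?\<Delta> v w \<longlongrightarrow> B v) (at_right 0)"
    using second_difference_quotient_tendsto[OF assms(1-3,5), of v] by simp
  then show ?thesis
    using second_difference_quotient_tendsto[OF assms(1-4), of w]
    by (intro tendsto_unique[of "at_right 0"]) simp_all
qed

lemma second_derivative_symmetric:
  fixes f :: "'a::real_normed_vector \<Rightarrow> 'b::euclidean_space"
  assumes "open T" "x \<in> T"
    and der: "\<And>y. y \<in> T \<Longrightarrow> (f has_derivative f' y) (at y)"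
    and A: "((\<lambda>y. f' y v) has_derivative A) (at x)"
    and B: "((\<lambda>y. f' y w) has_derivative B) (at x)"
  shows "A w = B v"
proof (rule euclidean_eqI)
  fix b :: 'b
  show "A w \<bullet> b = B v \<bullet> b"
  proof (rule second_derivative_symmetric_real[OF assms(1,2), of "\<lambda>y. f y \<bullet> b" "\<lambda>y k. f' y k \<bullet> b"])
    show "((\<lambda>y. f y \<bullet> b) has_derivative (\<lambda>k. f' y k \<bullet> b)) (at y)" if "y \<in> T" for y
      using der[OF that] by (rule has_derivative_inner_left)
  qed (use A B in \<open>auto intro: has_derivative_inner_left\<close>)
qed

text \<open>
  What the Jacobi identity uses of the functions in the bracket. Unlike \<open>smooth_on\<close>, it speaks of
  derivatives within the set, and it is easily seen to be stable under sums, products and linear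
  substitutions.
\<close>

definition twice_diff_on :: "'a::real_normed_vector set \<Rightarrow> ('a \<Rightarrow> 'b::real_normed_vector) \<Rightarrow> bool" where
  "twice_diff_on S f \<longleftrightarrow> (\<exists>f' f''. \<forall>x\<in>S.
     (f has_derivative f' x) (at x within S) \<and>
     (\<forall>v. ((\<lambda>y. f' y v) has_derivative f'' x v) (at x within S)) \<and>
     (\<forall>v w. f'' x v w = f'' x w v))"

lemma twice_diff_onE:
  assumes "twice_diff_on S f"
  obtains f' f'' where
    "\<forall>x\<in>S. (f has_derivative f' x) (at x within S)"
    "\<forall>x\<in>S. \<forall>v. ((\<lambda>y. f' y v) has_derivative f'' x v) (at x within S)"
    "\<forall>x\<in>S. \<forall>v w. f'' x v w = f'' x w v"
  using assms unfolding twice_diff_on_def by blast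

lemma twice_diff_onI:
  assumes "\<And>x. x \<in> S \<Longrightarrow> (f has_derivative f' x) (at x within S)"
    "\<And>x v. x \<in> S \<Longrightarrow> ((\<lambda>y. f' y v) has_derivative f'' x v) (at x within S)"
    "\<And>x v w. x \<in> S \<Longrightarrow> f'' x v w = f'' x w v"
  shows "twice_diff_on S f"
  using assms unfolding twice_diff_on_def by blast

text \<open>
  The second derivatives are those of a smooth extension, so at boundary points their symmetry comes
  from the open neighbourhood.
\<close>

lemma twice_diff_on_smooth:
  fixes f :: "'a::real_normed_vector \<Rightarrow> 'b::euclidean_space"
  assumes "smooth_on S f"
  shows "twice_diff_on S f"
proof -
  obtain T g where T: "open T" "S \<subseteq> T" "\<forall>x\<in>S. g x = f x" and C: "C_k_open 2 T g"
    using assms unfolding smooth_on_def by blast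
  define g' where "g' = (\<lambda>x. frechet_derivative g (at x))"
  define g'' where "g'' = (\<lambda>x v. frechet_derivative (\<lambda>y. g' y v) (at x))"
  have g': "(g has_derivative g' x) (at x)" if "x \<in> T" for x
    using C that T(1) unfolding g'_def
    by (auto simp: numeral_2_eq_2 differentiable_on_eq_differentiable_at frechet_derivative_works[symmetric])
  have g'': "((\<lambda>y. g' y v) has_derivative g'' x v) (at x)" if "x \<in> T" for x v
    using C that T(1) unfolding g''_def g'_def
    by (auto simp: numeral_2_eq_2 differentiable_on_eq_differentiable_at frechet_derivative_works[symmetric])
  show ?thesis
  proof (rule twice_diff_onI)
    fix x assume x: "x \<in> S"
    show "(f has_derivative g' x) (at x within S)"
      using has_derivative_at_withinI[OF g'] T x
      by (intro has_derivative_transform[of x S f g]) auto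
    show "((\<lambda>y. g' y v) has_derivative g'' x v) (at x within S)" for v
      using has_derivative_at_withinI[OF g''] T x by blast
    show "g'' x v w = g'' x w v" for v w
      using second_derivative_symmetric[OF T(1) _ g' g'' g''] T x by blast
  qed
qed

lemma twice_diff_on_bounded_linear:
  assumes "bounded_linear f"
  shows "twice_diff_on S f"
  by (rule twice_diff_onI[where f' = "\<lambda>x. f" and f'' = "\<lambda>x v w. 0"])
     (auto intro: bounded_linear_imp_has_derivative assms)

lemma twice_diff_on_const: "twice_diff_on S (\<lambda>x. c)"
  by (rule twice_diff_onI[where f' = "\<lambda>x v. 0" and f'' = "\<lambda>x v w. 0"]) auto

lemma twice_diff_on_add:
  assumes "twice_diff_on S f" "twice_diff_on S g"
  shows "twice_diff_on S (\<lambda>x. f x + g x)"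
proof -
  obtain f' f'' where f:
    "\<forall>x\<in>S. (f has_derivative f' x) (at x within S)"
    "\<forall>x\<in>S. \<forall>v. ((\<lambda>y. f' y v) has_derivative f'' x v) (at x within S)"
    "\<forall>x\<in>S. \<forall>v w. f'' x v w = f'' x w v"
    using twice_diff_onE[OF assms(1)] .
  obtain g' g'' where g:
    "\<forall>x\<in>S. (g has_derivative g' x) (at x within S)"
    "\<forall>x\<in>S. \<forall>v. ((\<lambda>y. g' y v) has_derivative g'' x v) (at x within S)"
    "\<forall>x\<in>S. \<forall>v w. g'' x v w = g'' x w v"
    using twice_diff_onE[OF assms(2)] .
  show ?thesis
  proof (rule twice_diff_onI)
    fix x assume x: "x \<in> S"
    show "((\<lambda>x. f x + g x) has_derivative (\<lambda>v. f' x v + g' x v)) (at x within S)"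
      using f(1,2) g(1,2) x by (intro has_derivative_add) auto
    show "((\<lambda>y. f' y v + g' y v) has_derivative (\<lambda>w. f'' x v w + g'' x v w)) (at x within S)" for v
      using f(1,2) g(1,2) x by (intro has_derivative_add) auto
    show "f'' x v w + g'' x v w = f'' x w v + g'' x w v" for v w
      using f(3) g(3) x by simp
  qed
qed

lemma twice_diff_on_sum:
  assumes "\<And>i. i \<in> I \<Longrightarrow> twice_diff_on S (f i)"
  shows "twice_diff_on S (\<lambda>x. \<Sum>i\<in>I. f i x)"
  using assms
  by (induction I rule: infinite_finite_induct)
     (auto intro: twice_diff_on_const twice_diff_on_add)

lemma twice_diff_on_bilinear:
  assumes "bounded_bilinear mul" "twice_diff_on S f" "twice_diff_on S g"
  shows "twice_diff_on S (\<lambda>x. mul (f x) (g x))"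
proof -
  interpret bounded_bilinear mul by fact
  obtain f' f'' where f:
    "\<forall>x\<in>S. (f has_derivative f' x) (at x within S)"
    "\<forall>x\<in>S. \<forall>v. ((\<lambda>y. f' y v) has_derivative f'' x v) (at x within S)"
    "\<forall>x\<in>S. \<forall>v w. f'' x v w = f'' x w v"
    using twice_diff_onE[OF assms(2)] .
  obtain g' g'' where g:
    "\<forall>x\<in>S. (g has_derivative g' x) (at x within S)"
    "\<forall>x\<in>S. \<forall>v. ((\<lambda>y. g' y v) has_derivative g'' x v) (at x within S)"
    "\<forall>x\<in>S. \<forall>v w. g'' x v w = g'' x w v"
    using twice_diff_onE[OF assms(3)] .
  show ?thesis
  proof (rule twice_diff_onI)
    fix x assume x: "x \<in> S"
    show "((\<lambda>x. mul (f x) (g x)) has_derivative (\<lambda>v. mul (f x) (g' x v) + mul (f' x v) (g x))) (at x within S)"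
      using f(1,2) g(1,2) x by (intro FDERIV) auto
    show "((\<lambda>y. mul (f y) (g' y v) + mul (f' y v) (g y)) has_derivative
       (\<lambda>w. (mul (f x) (g'' x v w) + mul (f' x w) (g' x v)) + (mul (f' x v) (g' x w) + mul (f'' x v w) (g x))))
       (at x within S)" for v
      using f(1,2) g(1,2) x by (intro has_derivative_add FDERIV) auto
    show "(mul (f x) (g'' x v w) + mul (f' x w) (g' x v)) + (mul (f' x v) (g' x w) + mul (f'' x v w) (g x)) =
      (mul (f x) (g'' x w v) + mul (f' x v) (g' x w)) + (mul (f' x w) (g' x v) + mul (f'' x w v) (g x))" for v w
      using f(3) g(3) x by simp
  qed
qed

lemma twice_diff_on_linear_compose:
  assumes "bounded_linear L" "L ` S \<subseteq> S'" "twice_diff_on S' f"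
  shows "twice_diff_on S (\<lambda>x. f (L x))"
proof -
  obtain f' f'' where f:
    "\<forall>x\<in>S'. (f has_derivative f' x) (at x within S')"
    "\<forall>x\<in>S'. \<forall>v. ((\<lambda>y. f' y v) has_derivative f'' x v) (at x within S')"
    "\<forall>x\<in>S'. \<forall>v w. f'' x v w = f'' x w v"
    using twice_diff_onE[OF assms(3)] .
  have comp: "((\<lambda>x. h (L x)) has_derivative (\<lambda>v. h' (L v))) (at x within S)"
    if "(h has_derivative h' ) (at (L x) within S')" "x \<in> S" for h :: "'b \<Rightarrow> 'c" and h' x
    using has_derivative_in_compose[OF bounded_linear_imp_has_derivative[OF assms(1)]
        has_derivative_subset[OF that(1) assms(2)]] .
  show ?thesis
  proof (rule twice_diff_onI)
    fix x assume x: "x \<in> S"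
    then have Lx: "L x \<in> S'" using assms(2) by blast
    show "((\<lambda>x. f (L x)) has_derivative (\<lambda>v. f' (L x) (L v))) (at x within S)"
      using comp[OF f(1)[rule_format, OF Lx] x] .
    show "((\<lambda>y. f' (L y) (L v)) has_derivative (\<lambda>w. f'' (L x) (L v) (L w))) (at x within S)" for v
      using comp[OF f(2)[rule_format, OF Lx] x] .
    show "f'' (L x) (L v) (L w) = f'' (L x) (L w) (L v)" for v w
      using f(3) Lx by blast
  qed
qed

section \<open>Brackets given by a matrix\<close>

text \<open>
  The condition under which derivatives within a set are unique: from each of its points there are
  arbitrarily small steps along every axis that stay in the set.
\<close>

definition axis_accessible :: "'a::euclidean_space set \<Rightarrow> bool" where
  "axis_accessible S \<longleftrightarrow> (\<forall>x\<in>S. \<forall>i\<in>Basis. \<forall>e>0. \<exists>d. 0 < \<bar>d\<bar> \<and> \<bar>d\<bar> < e \<and> x + d *\<^sub>R i \<in> S)"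

lemma frechet_derivative_axis_accessible:
  assumes "axis_accessible S" "x \<in> S" "(f has_derivative f') (at x within S)"
  shows "frechet_derivative f (at x within S) = f'"
proof -
  have "(f has_derivative frechet_derivative f (at x within S)) (at x within S)"
    using assms(3) by (metis differentiableI frechet_derivative_works)
  then show ?thesis
    using frechet_derivative_unique_within[OF _ assms(3)] assms(1,2) unfolding axis_accessible_def by blast
qed

lemma linear_eq_sum_axis:
  fixes f :: "real^'n \<Rightarrow> 'b::real_vector"
  assumes "linear f"
  shows "f w = (\<Sum>i\<in>UNIV. (w $ i) *\<^sub>R f (axis i 1))"
proof -
  have "f w = f (\<Sum>i\<in>UNIV. (w $ i) *\<^sub>R axis i 1)"
    using basis_expansion[of w] by (simp add: scalar_mult_eq_scaleR)
  then show ?thesis by (simp add: linear_sum[OF assms] linear_cmul[OF assms])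
qed

lemma gradient_inner:
  fixes f :: "real^'n \<Rightarrow> real"
  assumes "axis_accessible S" "x \<in> S" "(f has_derivative f') (at x within S)"
  shows "gradient S f x \<bullet> w = f' w"
proof -
  have "linear f'" using assms(3) has_derivative_linear by blast
  then show ?thesis
    by (subst linear_eq_sum_axis[of f'])
       (simp_all add: gradient_def partial_deriv_def frechet_derivative_axis_accessible[OF assms] inner_vec_def mult.commute)
qed

lemma gradient_has_derivative:
  fixes f :: "real^'n \<Rightarrow> real"
  assumes "axis_accessible S" "x \<in> S" "twice_diff_on S f"
  obtains H where "(gradient S f has_derivative H) (at x within S)" "\<And>v w. H v \<bullet> w = H w \<bullet> v"
proof -
  obtain f' f'' where f: "\<forall>x\<in>S. (f has_derivative f' x) (at x within S)"
    "\<forall>x\<in>S. \<forall>v. ((\<lambda>y. f' y v) has_derivative f'' x v) (at x within S)"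
    "\<forall>x\<in>S. \<forall>v w. f'' x v w = f'' x w v"
    using twice_diff_onE[OF assms(3)] .
  define H where "H = (\<lambda>w. \<chi> i. f'' x (axis i 1) w)"
  have Hinner: "H w \<bullet> v = f'' x v w" for v w
  proof -
    have "linear (f'' x w)" using f(2) assms(2) has_derivative_linear by blast
    then have "f'' x w v = (\<Sum>i\<in>UNIV. (v $ i) *\<^sub>R f'' x w (axis i 1))" by (rule linear_eq_sum_axis)
    also have "\<dots> = (\<Sum>i\<in>UNIV. (v $ i) *\<^sub>R f'' x (axis i 1) w)"
      using f(3) assms(2) by (intro sum.cong refl) metis
    also have "\<dots> = H w \<bullet> v" by (simp add: H_def inner_vec_def mult.commute)
    finally show ?thesis using f(3) assms(2) by metis
  qed
  have grad: "gradient S f y \<bullet> v = f' y v" if "y \<in> S" for y v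
    using gradient_inner[OF assms(1) that] f(1) that by blast
  have "(gradient S f has_derivative H) (at x within S)"
    unfolding has_derivative_componentwise_within[of "gradient S f"]
  proof
    fix v :: "real^'n"
    have "((\<lambda>y. f' y v) has_derivative (\<lambda>w. H w \<bullet> v)) (at x within S)"
      using f(2) assms(2) by (simp add: Hinner)
    then show "((\<lambda>y. gradient S f y \<bullet> v) has_derivative (\<lambda>w. H w \<bullet> v)) (at x within S)"
      by (rule has_derivative_transform[OF assms(2), rotated]) (simp add: grad)
  qed
  moreover have "H v \<bullet> w = H w \<bullet> v" for v w
    using f(3) assms(2) by (simp add: Hinner)
  ultimately show thesis by (rule that)
qed

lemma bounded_bilinear_matrix_vector_mult:
  "bounded_bilinear (\<lambda>(A :: real^'n^'m) x. A *v x)"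
  unfolding bilinear_conv_bounded_bilinear[symmetric] bilinear_def
  by (auto intro!: linearI simp: matrix_vector_right_distrib matrix_vector_mult_add_rdistrib
      matrix_vector_mult_scaleR scaleR_matrix_vector_assoc)

lemmas matrix_vector_has_derivative =
  bounded_bilinear.FDERIV[OF bounded_bilinear_matrix_vector_mult]

definition matrix_bracket ::
    "(real^'n) set \<Rightarrow> (real^'n \<Rightarrow> real^'n^'n) \<Rightarrow> (real^'n \<Rightarrow> real) \<Rightarrow> (real^'n \<Rightarrow> real) \<Rightarrow> real^'n \<Rightarrow> real" where
  "matrix_bracket S J f g u = gradient S f u \<bullet> (J u *v gradient S g u)"

definition jacobiator :: "(('a \<Rightarrow> real) \<Rightarrow> ('a \<Rightarrow> real) \<Rightarrow> 'a \<Rightarrow> real) \<Rightarrow>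
    ('a \<Rightarrow> real) \<Rightarrow> ('a \<Rightarrow> real) \<Rightarrow> ('a \<Rightarrow> real) \<Rightarrow> 'a \<Rightarrow> real" where
  "jacobiator br f g h u = br (br f g) h u + br (br g h) f u + br (br h f) g u"

text \<open>
  The product rule applied to \<open>\<nabla>f \<bullet> J \<nabla>g\<close> in the direction \<open>J \<nabla>h\<close>. Antisymmetry of \<open>J\<close> moves \<open>J\<close>
  away from the Hessian of \<open>g\<close>, so that the two Hessian terms are of one form.
\<close>

lemma matrix_bracket_nested:
  fixes J :: "real^'n \<Rightarrow> real^'n^'n"
  assumes S: "axis_accessible S" "u \<in> S"
    and anti: "\<And>a b. a \<bullet> (J u *v b) = - (b \<bullet> (J u *v a))"
    and J': "(J has_derivative J') (at u within S)"
    and Hf: "(gradient S f has_derivative Hf) (at u within S)"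
    and Hg: "(gradient S g has_derivative Hg) (at u within S)"
  shows "matrix_bracket S J (matrix_bracket S J f g) h u =
     Hf (J u *v gradient S h u) \<bullet> (J u *v gradient S g u)
   - Hg (J u *v gradient S h u) \<bullet> (J u *v gradient S f u)
   + gradient S f u \<bullet> (J' (J u *v gradient S h u) *v gradient S g u)"
proof -
  have "((\<lambda>y. gradient S f y \<bullet> (J y *v gradient S g y)) has_derivative
     (\<lambda>w. gradient S f u \<bullet> (J u *v Hg w + J' w *v gradient S g u) + Hf w \<bullet> (J u *v gradient S g u)))
     (at u within S)"
    by (intro has_derivative_inner matrix_vector_has_derivative J' Hf Hg)
  from gradient_inner[OF S this] show ?thesis
    unfolding matrix_bracket_def[abs_def]
    using anti[of "gradient S f u"] by (simp add: inner_add_right)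
qed

text \<open>
  Each Hessian occurs twice in the cyclic sum, with opposite signs and its two arguments exchanged, so
  the symmetric Hessians cancel. The right-hand side contains the gradients at \<open>u\<close> only, which allows
  each function to be replaced by a convenient one with the same gradient.
\<close>

lemma jacobiator_tensorial:
  fixes J :: "real^'n \<Rightarrow> real^'n^'n"
  assumes S: "axis_accessible S" "u \<in> S"
    and anti: "\<And>a b. a \<bullet> (J u *v b) = - (b \<bullet> (J u *v a))"
    and J': "(J has_derivative J') (at u within S)"
    and "twice_diff_on S f" "twice_diff_on S g" "twice_diff_on S h"
  shows "jacobiator (matrix_bracket S J) f g h u =
     gradient S f u \<bullet> (J' (J u *v gradient S h u) *v gradient S g u)
   + gradient S g u \<bullet> (J' (J u *v gradient S f u) *v gradient S h u)
   + gradient S h u \<bullet> (J' (J u *v gradient S g u) *v gradient S f u)"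
proof -
  obtain Hf where f: "(gradient S f has_derivative Hf) (at u within S)" "\<And>v w. Hf v \<bullet> w = Hf w \<bullet> v"
    using gradient_has_derivative[OF S assms(5)] by blast
  obtain Hg where g: "(gradient S g has_derivative Hg) (at u within S)" "\<And>v w. Hg v \<bullet> w = Hg w \<bullet> v"
    using gradient_has_derivative[OF S assms(6)] by blast
  obtain Hh where h: "(gradient S h has_derivative Hh) (at u within S)" "\<And>v w. Hh v \<bullet> w = Hh w \<bullet> v"
    using gradient_has_derivative[OF S assms(7)] by blast
  note nested = matrix_bracket_nested[OF S anti J']
  show ?thesis
    unfolding jacobiator_def nested[OF f(1) g(1)] nested[OF g(1) h(1)] nested[OF h(1) f(1)]
    using f(2)[of "J u *v gradient S h u" "J u *v gradient S g u"]
      g(2)[of "J u *v gradient S h u" "J u *v gradient S f u"]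
      h(2)[of "J u *v gradient S f u" "J u *v gradient S g u"]
    by simp
qed

lemma differentiable_matrix_entries:
  fixes J :: "'a::real_normed_vector \<Rightarrow> real^'n^'m"
  assumes "\<And>i j. (\<lambda>y. J y $ i $ j) differentiable Fl"
  shows "J differentiable Fl"
proof -
  obtain D where D: "\<And>i j. ((\<lambda>y. J y $ i $ j) has_derivative D i j) Fl"
    using assms unfolding differentiable_def by metis
  have eq: "J = (\<lambda>y. \<Sum>i\<in>UNIV. \<Sum>j\<in>UNIV. (J y $ i $ j) *\<^sub>R axis i (axis j 1))"
  proof
    fix y
    have ax: "(axis i (axis j 1) :: real^'n^'m) $ a $ b = (if j = b then if i = a then 1 else 0 else 0)" for i j a b
      by (simp add: axis_def)
    show "J y = (\<Sum>i\<in>UNIV. \<Sum>j\<in>UNIV. (J y $ i $ j) *\<^sub>R axis i (axis j 1))"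
      unfolding vec_eq_iff by (simp add: ax if_distrib[of "\<lambda>t. _ * t"] cong: if_cong)
  qed
  have "((\<lambda>y. \<Sum>i\<in>UNIV. \<Sum>j\<in>UNIV. (J y $ i $ j) *\<^sub>R (axis i (axis j 1) :: real^'n^'m)) has_derivative
      (\<lambda>w. \<Sum>i\<in>UNIV. \<Sum>j\<in>UNIV. D i j w *\<^sub>R axis i (axis j 1))) Fl"
    by (intro has_derivative_sum has_derivative_scaleR_left D)
  then show ?thesis
    unfolding eq[symmetric] by (rule differentiableI)
qed

lemma
  fixes J :: "real^'n \<Rightarrow> real^'n^'n"
  assumes S: "axis_accessible S" "u \<in> S" and f: "f differentiable at u within S" and g: "g differentiable at u within S"
  shows gradient_linear_combination:
      "gradient S (\<lambda>x. \<alpha> * f x + \<beta> * g x) u = \<alpha> *\<^sub>R gradient S f u + \<beta> *\<^sub>R gradient S g u"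
    and gradient_mult:
      "gradient S (\<lambda>x. f x * g x) u = f u *\<^sub>R gradient S g u + g u *\<^sub>R gradient S f u"
proof -
  obtain f' g' where d: "(f has_derivative f') (at u within S)" "(g has_derivative g') (at u within S)"
    using f g unfolding differentiable_def by blast
  have 1: "((\<lambda>x. \<alpha> * f x + \<beta> * g x) has_derivative (\<lambda>w. \<alpha> * f' w + \<beta> * g' w)) (at u within S)"
    by (intro has_derivative_add has_derivative_mult_right d)
  show "gradient S (\<lambda>x. \<alpha> * f x + \<beta> * g x) u = \<alpha> *\<^sub>R gradient S f u + \<beta> *\<^sub>R gradient S g u"
    by (rule vector_eq_rdot[THEN iffD1])
       (simp add: inner_add_left gradient_inner[OF S 1] gradient_inner[OF S d(1)] gradient_inner[OF S d(2)])
  have 2: "((\<lambda>x. f x * g x) has_derivative (\<lambda>w. f u * g' w + f' w * g u)) (at u within S)"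
    by (intro has_derivative_mult d)
  show "gradient S (\<lambda>x. f x * g x) u = f u *\<^sub>R gradient S g u + g u *\<^sub>R gradient S f u"
    by (rule vector_eq_rdot[THEN iffD1])
       (simp add: inner_add_left gradient_inner[OF S 2] gradient_inner[OF S d(1)] gradient_inner[OF S d(2)])
qed

section \<open>Inverse matrices\<close>

lemma invertible_matrix_inv_unique:
  fixes A B :: "real^'n^'n"
  assumes "A ** B = mat 1"
  shows "matrix_inv A = B"
proof -
  have BA: "B ** A = mat 1" using assms matrix_left_right_inverse by blast
  have "A ** matrix_inv A = mat 1"
    unfolding matrix_inv_def by (rule someI2[of _ B]) (use assms BA in auto)
  then have "B ** (A ** matrix_inv A) = B" by simp
  then show ?thesis by (simp add: matrix_mul_assoc BA)
qed

lemma matrix_inv_right_inverse: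
  fixes A :: "real^'n^'n"
  assumes "invertible A"
  shows "A ** matrix_inv A = mat 1" "matrix_inv A ** A = mat 1"
  using assms invertible_matrix_inv_unique matrix_left_right_inverse
  unfolding invertible_def by metis+

lemma transpose_matrix_inv:
  fixes A :: "real^'n^'n"
  assumes "invertible A"
  shows "transpose (matrix_inv A) = matrix_inv (transpose A)"
  by (rule invertible_matrix_inv_unique[symmetric])
     (simp add: matrix_transpose_mul[symmetric] matrix_inv_right_inverse[OF assms])

lemma invertible_symmetric_positive_definite:
  assumes "symmetric_positive_definite A"
  shows "invertible A"
proof -
  have "x = 0" if "A *v x = 0" for x
    using assms that unfolding symmetric_positive_definite_def by (metis inner_zero_right less_irrefl)
  then show ?thesis by (simp add: invertible_left_inverse matrix_left_invertible_ker)
qed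

text \<open>
  The classical adjugate, whose columns are the cross products of the rows. Its entries are polynomials,
  so \<open>A\<inverse> = adj A / det A\<close> shows that inversion is differentiable.
\<close>

definition adjugate3 :: "real^3^3 \<Rightarrow> real^3^3" where
  "adjugate3 A = transpose (vector [cross3 (A $ 2) (A $ 3), cross3 (A $ 3) (A $ 1), cross3 (A $ 1) (A $ 2)])"

lemma matrix_mult_adjugate3: "A ** adjugate3 A = det A *\<^sub>R mat 1"
  by (simp add: vec_eq_iff forall_3 matrix_matrix_mult_def sum_3 adjugate3_def transpose_def
      cross3_def mat_def det_3 algebra_simps)

lemma matrix_inv_adjugate3:
  fixes A :: "real^3^3"
  assumes "det A \<noteq> 0"
  shows "matrix_inv A = (1 / det A) *\<^sub>R adjugate3 A"
  by (rule invertible_matrix_inv_unique)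
     (simp add: matrix_scalar_ac matrix_mult_adjugate3 assms flip: scalar_matrix_assoc)

lemma differentiable_matrix_inv:
  fixes A :: "'a::real_normed_vector \<Rightarrow> real^3^3"
  assumes A: "A differentiable at x within S" and "x \<in> S"
    and nz: "\<And>y. y \<in> S \<Longrightarrow> det (A y) \<noteq> 0"
  shows "(\<lambda>y. matrix_inv (A y)) differentiable at x within S"
proof -
  have entry: "(\<lambda>y. A y $ i $ j) differentiable at x within S" for i j
  proof -
    obtain D where "(A has_derivative D) (at x within S)" using A by (auto simp: differentiable_def)
    then have "((\<lambda>y. A y $ i $ j) has_derivative (\<lambda>w. D w $ i $ j)) (at x within S)"
      by (intro bounded_linear.has_derivative[OF bounded_linear_vec_nth])
    then show ?thesis by (rule differentiableI)
  qed
  have "(\<lambda>y. inverse (det (A y))) differentiable at x within S"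
    unfolding det_3 using nz[OF \<open>x \<in> S\<close>, unfolded det_3]
    by (intro differentiable_inverse derivative_intros entry)
  moreover have "(\<lambda>y. adjugate3 (A y) $ i $ j) differentiable at x within S" for i j
    using exhaust_3[of i] exhaust_3[of j]
    by (elim disjE; simp add: adjugate3_def transpose_def cross3_def; intro derivative_intros entry)
  ultimately have "(\<lambda>y. ((1 / det (A y)) *\<^sub>R adjugate3 (A y)) $ i $ j) differentiable at x within S" for i j
    by (simp add: divide_inverse)
  then have "(\<lambda>y. (1 / det (A y)) *\<^sub>R adjugate3 (A y)) differentiable at x within S"
    by (rule differentiable_matrix_entries)
  then show ?thesis
    unfolding differentiable_def
    by (metis (no_types, lifting) \<open>x \<in> S\<close> has_derivative_transform matrix_inv_adjugate3 nz)
qed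

section \<open>Blocks of states and matrices\<close>

definition slot :: "real^('p::finite \<times> 'a::finite) \<Rightarrow> 'p \<Rightarrow> real^'a" where
  "slot w p = (\<chi> k. w $ (p, k))"

lemma sum_UNIV_Times:
  "(\<Sum>j\<in>UNIV. f j) = (\<Sum>p\<in>UNIV. \<Sum>k\<in>UNIV. f (p, k))" for f :: "'p::finite \<times> 'a::finite \<Rightarrow> real"
  by (simp add: sum.cartesian_product UNIV_Times_UNIV[symmetric] del: UNIV_Times_UNIV)

lemma sum_UNIV_Plus:
  "(\<Sum>j\<in>UNIV. f j) = (\<Sum>a\<in>UNIV. f (Inl a)) + (\<Sum>b\<in>UNIV. f (Inr b))"
  for f :: "'p::finite + 'a::finite \<Rightarrow> real"
  by (simp add: UNIV_Plus_UNIV[symmetric] sum.Plus del: UNIV_Plus_UNIV)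

lemma slot_block_diag: "slot (block_diag A *v w) p = A p *v slot w p"
proof -
  have eq: "(\<Sum>k\<in>UNIV. (if p = q then A p $ i $ k else 0) * w $ (q, k)) =
      (if p = q then \<Sum>k\<in>UNIV. A p $ i $ k * w $ (q, k) else 0)" for i q
    by simp
  then show ?thesis
    by (simp add: vec_eq_iff slot_def block_diag_def matrix_vector_mult_def sum_UNIV_Times eq cong: if_cong)
qed

lemma transpose_block_diag: "transpose (block_diag A) = block_diag (\<lambda>p. transpose (A p))"
  by (auto simp: vec_eq_iff transpose_def block_diag_def)

lemma slot_block_stack: "slot (block_stack A *v w) p = A p *v w"
  by (simp add: vec_eq_iff slot_def block_stack_def matrix_vector_mult_def)

lemma transpose_block_stack_mult:
  "transpose (block_stack A) *v w = (\<Sum>p\<in>UNIV. transpose (A p) *v slot w p)"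
  by (simp add: vec_eq_iff slot_def block_stack_def matrix_vector_mult_def transpose_def sum_UNIV_Times
      del: transpose_matrix_vector)

lemma particle_diag_block_diag: "particle_diag d = block_diag (\<lambda>p. d p *\<^sub>R mat 1)"
  by (auto simp: vec_eq_iff particle_diag_def kronecker_def diag_def mat_def block_diag_def)

lemma slot_particle_diag: "slot (particle_diag d *v w) p = d p *\<^sub>R slot w p"
  by (simp add: particle_diag_block_diag slot_block_diag flip: scaleR_matrix_vector_assoc)

lemma slot_eqI: "(\<And>p. slot v p = slot w p) \<Longrightarrow> v = w"
  by (auto simp: slot_def vec_eq_iff)

lemma matrix_inv_particle_diag:
  assumes "\<And>p. d p \<noteq> 0"
  shows "matrix_inv (particle_diag d) = particle_diag (\<lambda>p. 1 / d p)"
proof (rule invertible_matrix_inv_unique)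
  have "(particle_diag d ** particle_diag (\<lambda>p. 1 / d p)) *v w = mat 1 *v w" for w
    by (rule slot_eqI) (simp add: slot_particle_diag assms flip: matrix_vector_mul_assoc)
  then show "particle_diag d ** particle_diag (\<lambda>p. 1 / d p) = mat 1"
    unfolding matrix_eq by blast
qed

lemma block_row4_mult:
  "block_row4 A B C D *v c =
     A *v (\<chi> i. c $ Inl i) + B *v (\<chi> i. c $ Inr (Inl i)) +
     C *v (\<chi> i. c $ Inr (Inr (Inl i))) + D *v (\<chi> i. c $ Inr (Inr (Inr i)))"
  by (simp add: vec_eq_iff block_row4_def matrix_vector_mult_def sum_UNIV_Plus)

definition velocity :: "('p::finite, 'n1::finite, 'n2::finite) state \<Rightarrow> 'p \<Rightarrow> real^3" where
  "velocity u p = (\<chi> k. u $ Inr (Inl (p, k)))"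

definition e_coeff :: "('p::finite, 'n1::finite, 'n2::finite) state \<Rightarrow> real^('n1 \<times> 3)" where
  "e_coeff u = (\<chi> j. u $ Inr (Inr (Inl j)))"

lemma state_components_block_col4:
  "position (block_col4 A B C D *v c) p = slot (A *v c) p"
  "velocity (block_col4 A B C D *v c) p = slot (B *v c) p"
  "e_coeff (block_col4 A B C D *v c) = C *v c"
  "b_coeff (block_col4 A B C D *v c) = D *v c"
  by (simp_all add: vec_eq_iff position_def velocity_def e_coeff_def b_coeff_def slot_def
      block_col4_def matrix_vector_mult_def)

lemma slot_components:
  "slot (\<chi> i. c $ Inl i) p = position c p"
  "slot (\<chi> i. c $ Inr (Inl i)) p = velocity c p"
  by (simp_all add: slot_def position_def velocity_def)

lemma inner_state:
  "a \<bullet> b = (\<Sum>p\<in>UNIV. position a p \<bullet> position b p) + (\<Sum>p\<in>UNIV. velocity a p \<bullet> velocity b p)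
     + e_coeff a \<bullet> e_coeff b + b_coeff a \<bullet> b_coeff b"
  by (simp add: inner_vec_def sum_UNIV_Plus sum_UNIV_Times position_def velocity_def e_coeff_def b_coeff_def)

lemma state_eqI:
  assumes "\<And>p. position a p = position b p" "\<And>p. velocity a p = velocity b p"
    "e_coeff a = e_coeff b" "b_coeff a = b_coeff b"
  shows "a = b"
proof -
  have "a $ i = b $ i" for i
    using assms
  proof -
    consider p k where "i = Inl (p, k)" | p k where "i = Inr (Inl (p, k))"
      | j where "i = Inr (Inr (Inl j))" | j where "i = Inr (Inr (Inr j))"
      by (metis sum.exhaust prod.exhaust)
    then show ?thesis
      by cases (use assms in \<open>auto simp: position_def velocity_def e_coeff_def b_coeff_def vec_eq_iff\<close>)
  qed
  then show ?thesis by (simp add: vec_eq_iff)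
qed

lemma bounded_linear_state_components:
  "bounded_linear (\<lambda>u. position u p)" "bounded_linear (\<lambda>u. velocity u p)"
  "bounded_linear e_coeff" "bounded_linear b_coeff"
  unfolding linear_conv_bounded_linear[symmetric]
  by (auto intro!: linearI simp: vec_eq_iff position_def velocity_def e_coeff_def b_coeff_def)

lemmas matrix_vector_minus_left = bounded_bilinear.minus_left[OF bounded_bilinear_matrix_vector_mult]
lemmas matrix_vector_minus_right = bounded_bilinear.minus_right[OF bounded_bilinear_matrix_vector_mult]
lemmas matrix_vector_scaleR_right = bounded_bilinear.scaleR_right[OF bounded_bilinear_matrix_vector_mult]

lemma slot_add: "slot (v + w) p = slot v p + slot w p"
  and slot_minus: "slot (- v) p = - slot v p"
  and slot_diff: "slot (v - w) p = slot v p - slot w p"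
  by (simp_all add: slot_def vec_eq_iff)

section \<open>Derivatives on the cube\<close>

lemma axis_accessible_unit_slab: "axis_accessible {x :: real^'n. \<forall>i\<in>I. 0 \<le> x $ i \<and> x $ i \<le> 1}" (is "axis_accessible ?S")
  unfolding axis_accessible_def
proof (intro ballI allI impI)
  fix x b :: "real^'n" and e :: real
  assume x: "x \<in> ?S" and "b \<in> Basis" and e: "e > 0"
  then obtain k where b: "b = axis k 1" by (auto simp: Basis_vec_def)
  \<comment> \<open>A step towards the middle of the unit interval stays inside it.\<close>
  define d where "d = (if x $ k \<le> 1/2 then min (e/2) (1/2) else - min (e/2) (1/2))"
  have d: "0 < \<bar>d\<bar>" "\<bar>d\<bar> < e" "\<bar>d\<bar> \<le> 1/2" using e by (auto simp: d_def)
  have "x + d *\<^sub>R b \<in> ?S"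
    using x d e by (auto simp: b axis_def d_def)
  then show "\<exists>d. 0 < \<bar>d\<bar> \<and> \<bar>d\<bar> < e \<and> x + d *\<^sub>R b \<in> ?S" using d by blast
qed

lemma axis_accessible_cube: "axis_accessible cube"
proof -
  have eq: "cube = {x. \<forall>i\<in>UNIV. 0 \<le> x $ i \<and> x $ i \<le> 1}" by (auto simp: mem_box_cart)
  show ?thesis unfolding eq by (rule axis_accessible_unit_slab)
qed

lemma axis_accessible_state_space: "axis_accessible (state_space :: ('p::finite, 'n1::finite, 'n2::finite) state set)"
proof -
  have eq: "(state_space :: ('p, 'n1, 'n2) state set) = {x. \<forall>i\<in>range Inl. 0 \<le> x $ i \<and> x $ i \<le> 1}"
    by (auto simp: state_space_def mem_box_cart position_def)
  show ?thesis unfolding eq by (rule axis_accessible_unit_slab)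
qed

text \<open>
  The matrix \<open>DF F \<xi>\<close> is defined through a derivative that is chosen within the cube; this identifies
  it with the actual derivative.
\<close>

lemma DF_has_derivative:
  assumes "smooth_on cube F" "\<xi> \<in> cube"
  shows "(F has_derivative (\<lambda>k. DF F \<xi> *v k)) (at \<xi> within cube)"
proof -
  obtain F' where F': "(F has_derivative F') (at \<xi> within cube)"
    using twice_diff_onE[OF twice_diff_on_smooth[OF assms(1)]] assms(2) by metis
  have "DF F \<xi> *v k = F' k" for k
    using F' has_derivative_linear[OF F']
    by (simp add: DF_def jacobian_def frechet_derivative_axis_accessible[OF axis_accessible_cube assms(2)] matrix_works)
  then show ?thesis using F' by simp
qed

text \<open>
  Directional derivatives of a smooth extension are smooth. This is what makes the canonical momenta,
  which contain \<open>DF\<close>, twice differentiable.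
\<close>

lemma smooth_on_DF_mult:
  assumes "smooth_on cube F"
  shows "smooth_on cube (\<lambda>\<xi>. DF F \<xi> *v y)"
proof -
  obtain T g where T: "open T" "cube \<subseteq> T" "\<forall>x\<in>cube. g x = F x" and C: "\<forall>k. C_k_open k T g"
    using assms unfolding smooth_on_def by blast
  have "C_k_open k T (\<lambda>x. frechet_derivative g (at x) y)" for k
    using C[rule_format, of "Suc k"] by simp
  moreover have "frechet_derivative g (at \<xi>) y = DF F \<xi> *v y" if "\<xi> \<in> cube" for \<xi>
  proof -
    have "g differentiable at \<xi>"
      using C[rule_format, of 1] T that by (auto simp: differentiable_on_eq_differentiable_at)
    then have "(g has_derivative frechet_derivative g (at \<xi>)) (at \<xi> within cube)"
      by (metis frechet_derivative_works has_derivative_at_withinI)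
    then have "(F has_derivative frechet_derivative g (at \<xi>)) (at \<xi> within cube)"
      by (rule has_derivative_transform[OF that, rotated]) (use T in auto)
    note F' = frechet_derivative_axis_accessible[OF axis_accessible_cube that this]
    have "frechet_derivative F (at \<xi> within cube) = (\<lambda>k. DF F \<xi> *v k)"
      by (rule frechet_derivative_axis_accessible[OF axis_accessible_cube that DF_has_derivative[OF assms that]])
    with F' show ?thesis by simp
  qed
  ultimately show ?thesis
    unfolding smooth_on_def
    by (intro exI[of _ T] exI[of _ "\<lambda>x. frechet_derivative g (at x) y"] conjI allI ballI T)
qed

text \<open>
  The second derivative of \<open>F\<close> at \<open>\<xi>\<close>, as the derivative of \<open>\<eta> \<mapsto> DF(\<eta>) y\<close>. It appears in the
  gradient of the canonical momentum.
\<close>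

definition D2F :: "(real^3 \<Rightarrow> real^3) \<Rightarrow> real^3 \<Rightarrow> real^3 \<Rightarrow> real^3 \<Rightarrow> real^3" where
  "D2F F \<xi> y = frechet_derivative (\<lambda>\<eta>. DF F \<eta> *v y) (at \<xi> within cube)"

lemma D2F_has_derivative:
  assumes "smooth_on cube F" "\<xi> \<in> cube"
  shows "((\<lambda>\<eta>. DF F \<eta> *v y) has_derivative D2F F \<xi> y) (at \<xi> within cube)"
proof -
  obtain f' where "((\<lambda>\<eta>. DF F \<eta> *v y) has_derivative f') (at \<xi> within cube)"
    using twice_diff_onE[OF twice_diff_on_smooth[OF smooth_on_DF_mult[OF assms(1)]]] assms(2) by metis
  then show ?thesis
    unfolding D2F_def using frechet_derivative_axis_accessible[OF axis_accessible_cube assms(2)] by metis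
qed

lemma D2F_symmetric:
  assumes "smooth_on cube F" "\<xi> \<in> cube"
  shows "D2F F \<xi> y z = D2F F \<xi> z y"
proof -
  obtain f' f'' where f: "\<forall>x\<in>cube. (F has_derivative f' x) (at x within cube)"
    "\<forall>x\<in>cube. \<forall>v. ((\<lambda>y. f' y v) has_derivative f'' x v) (at x within cube)"
    "\<forall>x\<in>cube. \<forall>v w. f'' x v w = f'' x w v"
    using twice_diff_onE[OF twice_diff_on_smooth[OF assms(1)]] .
  have f': "f' x = (\<lambda>k. DF F x *v k)" if "x \<in> cube" for x
    using f(1) DF_has_derivative[OF assms(1) that] frechet_derivative_axis_accessible[OF axis_accessible_cube that] that by metis
  have "D2F F \<xi> v = f'' \<xi> v" for v
    unfolding D2F_def
  proof (rule frechet_derivative_axis_accessible[OF axis_accessible_cube assms(2)])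
    show "((\<lambda>\<eta>. DF F \<eta> *v v) has_derivative f'' \<xi> v) (at \<xi> within cube)"
      by (rule has_derivative_transform[OF assms(2) _ f(2)[rule_format, OF assms(2)]]) (simp add: f')
  qed
  then show ?thesis using f(3) assms(2) by metis
qed

lemma DF_differentiable:
  assumes "smooth_on cube F" "\<xi> \<in> cube"
  shows "DF F differentiable at \<xi> within cube"
proof (rule differentiable_matrix_entries)
  fix i j
  have "((\<lambda>\<eta>. (DF F \<eta> *v axis j 1) $ i) has_derivative (\<lambda>w. D2F F \<xi> (axis j 1) w $ i)) (at \<xi> within cube)"
    by (intro bounded_linear.has_derivative[OF bounded_linear_vec_nth] D2F_has_derivative assms)
  then show "(\<lambda>\<eta>. DF F \<eta> $ i $ j) differentiable at \<xi> within cube"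
    by (auto simp: matrix_vector_mult_basis column_def intro: differentiableI)
qed

text \<open>
  The left-hand side is alternating in the three vectors, hence a multiple of their determinant. For the
  derivative of a vector field, the factor is its divergence.
\<close>

lemma linear3_cyclic_trace:
  fixes A :: "real^3 \<Rightarrow> real^3"
  assumes "linear A"
  shows "cross3 x y \<bullet> A z + cross3 y z \<bullet> A x + cross3 z x \<bullet> A y
       = (x \<bullet> cross3 y z) * (\<Sum>i\<in>UNIV. A (axis i 1) $ i)"
  unfolding linear_eq_sum_axis[OF assms, of x] linear_eq_sum_axis[OF assms, of y] linear_eq_sum_axis[OF assms, of z]
  by (simp add: sum_3 inner_vec_def cross3_def) algebra

text \<open>
  For the derivative of a vector field, the vector on the right is its curl.
\<close>

lemma linear3_antisymmetric_part:
  fixes A :: "real^3 \<Rightarrow> real^3"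
  assumes "linear A"
  shows "y \<bullet> A x - x \<bullet> A y = cross3 x y \<bullet> vector
     [A (axis 2 1) $ 3 - A (axis 3 1) $ 2, A (axis 3 1) $ 1 - A (axis 1 1) $ 3, A (axis 1 1) $ 2 - A (axis 2 1) $ 1]"
  unfolding linear_eq_sum_axis[OF assms, of x] linear_eq_sum_axis[OF assms, of y]
  by (simp add: sum_3 inner_vec_def cross3_def) algebra

lemma column_component_partial_deriv:
  fixes \<Lambda> :: "real^3 \<Rightarrow> real^'j^3"
  assumes "(\<Lambda> has_derivative \<Lambda>') (at \<xi> within cube)" "\<xi> \<in> cube"
  shows "partial_deriv cube i (\<lambda>\<eta>. column j (\<Lambda> \<eta>) $ k) \<xi> = column j (\<Lambda>' (axis i 1)) $ k"
proof -
  have "((\<lambda>\<eta>. column j (\<Lambda> \<eta>) $ k) has_derivative (\<lambda>w. column j (\<Lambda>' w) $ k)) (at \<xi> within cube)"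
    unfolding column_def vec_lambda_beta
    by (intro bounded_linear.has_derivative[OF bounded_linear_vec_nth] assms)
  then show ?thesis
    by (simp add: partial_deriv_def frechet_derivative_axis_accessible[OF axis_accessible_cube assms(2)])
qed

lemma linear_column: "linear L \<Longrightarrow> linear (\<lambda>w. column j (L w))"
  by (auto intro!: linearI simp: column_def vec_eq_iff linear_add linear_cmul)

lemma inner_matrix_columns: "x \<bullet> (A *v c) = (\<Sum>j\<in>UNIV. c $ j * (x \<bullet> column j A))" for x :: "real^'n"
  by (simp add: matrix_mult_sum scalar_mult_eq_scaleR inner_sum_right)

text \<open>
  The columnwise curl relation, contracted with a coefficient vector. This is the identity behind the
  Jacobi sums with two momenta and one field coefficient \<open>e\<close>.
\<close>

lemma curl_relation_contracted:
  fixes \<Lambda> :: "real^3 \<Rightarrow> real^'j^3"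
  assumes "(\<Lambda> has_derivative \<Lambda>') (at \<xi> within cube)" "\<xi> \<in> cube"
    and curl: "\<And>j. curl cube (\<lambda>\<eta>. column j (\<Lambda> \<eta>)) \<xi> = column j R"
  shows "y \<bullet> (\<Lambda>' x *v c) - x \<bullet> (\<Lambda>' y *v c) = cross3 x y \<bullet> (R *v c)"
proof -
  have "y \<bullet> column j (\<Lambda>' x) - x \<bullet> column j (\<Lambda>' y) = cross3 x y \<bullet> column j R" for j
    unfolding linear3_antisymmetric_part[OF linear_column[OF has_derivative_linear[OF assms(1)]]]
      curl[symmetric] curl_def column_component_partial_deriv[OF assms(1,2)] ..
  then have "(\<Sum>j\<in>UNIV. c $ j * (y \<bullet> column j (\<Lambda>' x) - x \<bullet> column j (\<Lambda>' y)))
      = (\<Sum>j\<in>UNIV. c $ j * (cross3 x y \<bullet> column j R))"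
    by simp
  then show ?thesis
    by (simp add: inner_matrix_columns right_diff_distrib sum_subtractf)
qed

text \<open>
  The counterpart for three momenta: the Jacobi sum is proportional to \<open>R c\<close>, which vanishes by the
  discrete Gauss law when \<open>R = \<Lambda>3 D\<close> and \<open>c = b\<close>.
\<close>

lemma divergence_relation_contracted:
  fixes \<Lambda> :: "real^3 \<Rightarrow> real^'j^3" and R :: "real^'j^1"
  assumes "(\<Lambda> has_derivative \<Lambda>') (at \<xi> within cube)" "\<xi> \<in> cube"
    and div: "\<And>j. divergence cube (\<lambda>\<eta>. column j (\<Lambda> \<eta>)) \<xi> = R $ 1 $ j"
  shows "cross3 x y \<bullet> (\<Lambda>' z *v c) + cross3 y z \<bullet> (\<Lambda>' x *v c) + cross3 z x \<bullet> (\<Lambda>' y *v c)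
     = (x \<bullet> cross3 y z) * (R *v c) $ 1"
proof -
  have "cross3 x y \<bullet> column j (\<Lambda>' z) + cross3 y z \<bullet> column j (\<Lambda>' x) + cross3 z x \<bullet> column j (\<Lambda>' y)
     = (x \<bullet> cross3 y z) * R $ 1 $ j" for j
    unfolding linear3_cyclic_trace[OF linear_column[OF has_derivative_linear[OF assms(1)]]]
      div[symmetric] divergence_def column_component_partial_deriv[OF assms(1,2)] ..
  then have "(\<Sum>j\<in>UNIV. c $ j * (cross3 x y \<bullet> column j (\<Lambda>' z) + cross3 y z \<bullet> column j (\<Lambda>' x)
       + cross3 z x \<bullet> column j (\<Lambda>' y))) = (\<Sum>j\<in>UNIV. c $ j * ((x \<bullet> cross3 y z) * R $ 1 $ j))"
    by simp
  moreover have "(R *v c) $ 1 = (\<Sum>j\<in>UNIV. c $ j * R $ 1 $ j)"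
    by (simp add: matrix_vector_mult_def mult.commute)
  ultimately show ?thesis
    by (simp add: inner_matrix_columns distrib_left sum.distrib sum_distrib_left mult.left_commute)
qed

section \<open>The Poisson matrix in canonical momenta\<close>

lemma inner_matrix_adjoint: "x \<bullet> (A *v y) = (transpose A *v x) \<bullet> (y :: real^'n)"
  by (simp add: dot_lmul_matrix)

lemma inner_rot_matrix: "x \<bullet> (rot_matrix \<beta> *v y) = cross3 x y \<bullet> \<beta>"
  by (simp add: rot_matrix_def matrix_vector_mult_def inner_vec_def sum_3 cross3_def algebra_simps)

lemma bounded_bilinear_differentiable:
  assumes "bounded_bilinear mul" "f differentiable at x within S" "g differentiable at x within S"
  shows "(\<lambda>x. mul (f x) (g x)) differentiable at x within S"
  using assms bounded_bilinear.FDERIV unfolding differentiable_def by blast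

text \<open>
  The hypotheses that concern all states. The divergence relation is instead stated in the Jacobi
  identity, together with the Gauss law, which singles out states.
\<close>

locale particle_field_bracket =
  fixes F :: "real^3 \<Rightarrow> real^3"
    and \<Lambda>1 :: "real^3 \<Rightarrow> real^('n1::finite \<times> 3)^3"
    and \<Lambda>2 :: "real^3 \<Rightarrow> real^('n2::finite \<times> 3)^3"
    and C :: "real^('n1 \<times> 3)^('n2 \<times> 3)"
    and \<omega> m q :: "'p::finite \<Rightarrow> real"
  assumes smooth_F: "smooth_on cube F"
    and J_F_nonzero: "\<And>\<xi>. \<xi> \<in> cube \<Longrightarrow> J_F F \<xi> \<noteq> 0"
    and \<Lambda>1_diff: "\<Lambda>1 differentiable_on cube"
    and \<Lambda>2_diff: "\<Lambda>2 differentiable_on cube"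
    and curl_\<Lambda>1: "\<And>\<xi> j. \<xi> \<in> cube \<Longrightarrow> curl cube (\<lambda>\<eta>. column j (\<Lambda>1 \<eta>)) \<xi> = column j (\<Lambda>2 \<xi> ** C)"
    and mass_spd: "symmetric_positive_definite (mass_1 F \<Lambda>1)"
    and \<omega>_pos: "\<And>p. \<omega> p > 0" and m_pos: "\<And>p. m p > 0"
begin

abbreviation SS :: "('p, 'n1, 'n2) state set" where
  "SS \<equiv> state_space"

definition J :: "('p, 'n1, 'n2) state \<Rightarrow>
    real^('p \<times> 3 + 'p \<times> 3 + 'n1 \<times> 3 + 'n2 \<times> 3)^('p \<times> 3 + 'p \<times> 3 + 'n1 \<times> 3 + 'n2 \<times> 3)" where
  "J = poisson_matrix F \<Lambda>1 \<Lambda>2 C \<omega> m q"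

definition M1_inv :: "real^('n1 \<times> 3)^('n1 \<times> 3)" where
  "M1_inv = matrix_inv (mass_1 F \<Lambda>1)"

text \<open>
  If \<open>a\<close> is the gradient of a function with respect to \<open>(\<xi>, v, e, b)\<close>, this is its gradient with
  respect to the canonical momentum \<open>\<pi> = \<omega> m DF(\<xi>)\<^sup>T v\<close> of the particle \<open>p\<close>.
\<close>

definition mom :: "('p, 'n1, 'n2) state \<Rightarrow> ('p, 'n1, 'n2) state \<Rightarrow> 'p \<Rightarrow> real^3" where
  "mom u a p = (1 / (\<omega> p * m p)) *\<^sub>R (transpose (N_F F (position u p)) *v velocity a p)"

lemma weights_nonzero [simp]: "\<omega> p \<noteq> 0" "m p \<noteq> 0"
  using \<omega>_pos[of p] m_pos[of p] by auto

lemma position_in_cube: "u \<in> SS \<Longrightarrow> position u p \<in> cube"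
  by (simp add: state_space_def)

lemma inner_M1_inv: "x \<bullet> (M1_inv *v y) = (M1_inv *v x) \<bullet> y"
proof -
  have "transpose M1_inv = M1_inv"
    using mass_spd unfolding M1_inv_def
    by (simp add: transpose_matrix_inv invertible_symmetric_positive_definite symmetric_positive_definite_def)
  then show ?thesis by (metis inner_matrix_adjoint)
qed

lemma poisson_components:
  "position (J u *v c) p = mom u c p"
  "velocity (J u *v c) p = - ((1 / (\<omega> p * m p)) *\<^sub>R (N_F F (position u p) *v position c p))
     + (q p / m p) *\<^sub>R (N_F F (position u p) *v (rot_matrix (\<Lambda>2 (position u p) *v b_coeff u) *v mom u c p))
     + (q p / m p) *\<^sub>R (N_F F (position u p) *v (\<Lambda>1 (position u p) *v (M1_inv *v e_coeff c)))"
  "e_coeff (J u *v c) = - (M1_inv *v (\<Sum>p\<in>UNIV. (\<omega> p * q p) *\<^sub>R (transpose (\<Lambda>1 (position u p)) *v mom u c p)))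
     + M1_inv *v (transpose C *v b_coeff c)"
  "b_coeff (J u *v c) = - (C *v (M1_inv *v e_coeff c))"
  unfolding J_def poisson_matrix_def Let_def state_components_block_col4 block_row4_mult
    N_particles_def L1_particles_def B_particles_def M1_inv_def[symmetric]
  by (simp_all add: matrix_inv_particle_diag slot_components slot_block_diag slot_block_stack
      slot_particle_diag slot_add slot_diff slot_minus transpose_block_diag transpose_block_stack_mult
      matrix_vector_mul_assoc[symmetric] matrix_vector_minus_left matrix_vector_scaleR_right
      mom_def e_coeff_def[symmetric] b_coeff_def[symmetric] del: transpose_matrix_vector)

text \<open>
  The bracket in canonical form: the geometry survives only inside \<open>mom\<close>. The first difference is the
  canonical pairing of positions and momenta, the cross product is the magnetic term, and the other
  terms couple particles to the field and \<open>e\<close> to \<open>b\<close>.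
\<close>

lemma poisson_form:
  "a \<bullet> (J u *v c) = (\<Sum>p\<in>UNIV. position a p \<bullet> mom u c p - mom u a p \<bullet> position c p
     + \<omega> p * q p * (cross3 (mom u a p) (mom u c p) \<bullet> (\<Lambda>2 (position u p) *v b_coeff u)
        + mom u a p \<bullet> (\<Lambda>1 (position u p) *v (M1_inv *v e_coeff c))
        - mom u c p \<bullet> (\<Lambda>1 (position u p) *v (M1_inv *v e_coeff a))))
     + (C *v (M1_inv *v e_coeff a)) \<bullet> b_coeff c - b_coeff a \<bullet> (C *v (M1_inv *v e_coeff c))"
proof -
  have N: "(1 / (\<omega> p * m p)) * (velocity a p \<bullet> (N_F F (position u p) *v x)) = mom u a p \<bullet> x" for p x
    by (simp add: inner_matrix_adjoint mom_def del: transpose_matrix_vector)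
  have N': "(q p / m p) * (velocity a p \<bullet> (N_F F (position u p) *v x)) = \<omega> p * q p * (mom u a p \<bullet> x)" for p x
    unfolding N[symmetric] by simp
  have vel: "velocity a p \<bullet> velocity (J u *v c) p = - (mom u a p \<bullet> position c p)
      + \<omega> p * q p * (cross3 (mom u a p) (mom u c p) \<bullet> (\<Lambda>2 (position u p) *v b_coeff u))
      + \<omega> p * q p * (mom u a p \<bullet> (\<Lambda>1 (position u p) *v (M1_inv *v e_coeff c)))" for p
    unfolding poisson_components inner_add_right inner_minus_right inner_scaleR_right N N' inner_rot_matrix ..
  have e: "e_coeff a \<bullet> e_coeff (J u *v c) =
      - (\<Sum>p\<in>UNIV. \<omega> p * q p * (mom u c p \<bullet> (\<Lambda>1 (position u p) *v (M1_inv *v e_coeff a))))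
      + (C *v (M1_inv *v e_coeff a)) \<bullet> b_coeff c"
    unfolding poisson_components inner_add_right inner_minus_right inner_M1_inv inner_sum_right inner_scaleR_right
    by (simp add: inner_matrix_adjoint[of _ "transpose _"] inner_commute[of "mom u c _"] del: transpose_matrix_vector)
  show ?thesis
    unfolding inner_state vel e poisson_components(1,4)
    by (simp add: sum.distrib sum_subtractf sum_negf distrib_left right_diff_distrib)
qed

lemma poisson_antisymmetric: "a \<bullet> (J u *v c) = - (c \<bullet> (J u *v a))"
  unfolding poisson_form cross_skew[of "mom u c _" "mom u a _"]
  by (simp add: sum.distrib sum_subtractf sum_negf distrib_left right_diff_distrib inner_commute)

lemma transpose_N_F: "transpose (N_F F \<xi>) = matrix_inv (DF F \<xi>)"
  by (simp add: N_F_def)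

lemma DF_inverse:
  assumes "\<xi> \<in> cube"
  shows "matrix_inv (DF F \<xi>) *v (DF F \<xi> *v y) = y" "DF F \<xi> *v (matrix_inv (DF F \<xi>) *v y) = y"
proof -
  have "invertible (DF F \<xi>)"
    using J_F_nonzero[OF assms] by (simp add: J_F_def invertible_det_nz)
  then show "matrix_inv (DF F \<xi>) *v (DF F \<xi> *v y) = y" "DF F \<xi> *v (matrix_inv (DF F \<xi>) *v y) = y"
    by (simp_all add: matrix_vector_mul_assoc matrix_inv_right_inverse)
qed

lemma position_has_derivative:
  assumes "u \<in> SS" "(h has_derivative h') (at (position u p) within cube)"
  shows "((\<lambda>v. h (position v p)) has_derivative (\<lambda>w. h' (position w p))) (at u within SS)"
proof -
  have "(\<lambda>v. position v p) ` SS \<subseteq> cube" by (auto simp: state_space_def)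
  with assms(2) have "(h has_derivative h') (at (position u p) within (\<lambda>v. position v p) ` SS)"
    by (rule has_derivative_subset)
  from has_derivative_in_compose[OF bounded_linear_imp_has_derivative[OF bounded_linear_state_components(1)] this]
  show ?thesis .
qed

lemma position_differentiable:
  assumes "u \<in> SS" "h differentiable at (position u p) within cube"
  shows "(\<lambda>v. h (position v p)) differentiable at u within SS"
  using assms position_has_derivative unfolding differentiable_def by blast

lemma linear_differentiable: "bounded_linear h \<Longrightarrow> h differentiable at u within SS"
  by (auto intro: differentiableI bounded_linear_imp_has_derivative)

lemma mom_differentiable:
  assumes "u \<in> SS"
  shows "(\<lambda>v. mom v a p) differentiable at u within SS"
proof -
  have "(\<lambda>\<eta>. matrix_inv (DF F \<eta>)) differentiable at (position u p) within cube"
    using position_in_cube[OF assms] J_F_nonzero DF_differentiable[OF smooth_F]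
    by (intro differentiable_matrix_inv) (auto simp: J_F_def)
  from position_differentiable[OF assms this] show ?thesis
    unfolding mom_def transpose_N_F
    by (intro differentiable_scaleR bounded_bilinear_differentiable[OF bounded_bilinear_matrix_vector_mult]
        differentiable_const)
qed

text \<open>
  Differentiability of \<open>\<Lambda>1\<close> and \<open>\<Lambda>2\<close> is part of the setting, and \<open>N\<close> is differentiable because
  matrix inversion is.
\<close>

lemma poisson_differentiable:
  assumes u: "u \<in> SS"
  shows "J differentiable at u within SS"
proof (rule differentiable_matrix_entries)
  fix i j
  have L: "(\<lambda>v. \<Lambda>1 (position v p)) differentiable at u within SS"
    "(\<lambda>v. \<Lambda>2 (position v p)) differentiable at u within SS" for p
    using \<Lambda>1_diff \<Lambda>2_diff position_in_cube[OF u]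
    by (auto simp: differentiable_on_def intro!: position_differentiable u)
  have cross: "bounded_bilinear cross3"
    using bilinear_cross bilinear_conv_bounded_bilinear by blast
  note mv = bounded_bilinear_differentiable[OF bounded_bilinear_matrix_vector_mult]
  have magnetic: "(\<lambda>v. cross3 (mom v a p) (mom v c p) \<bullet> (\<Lambda>2 (position v p) *v b_coeff v))
      differentiable at u within SS" for a c p
    by (rule differentiable_inner[OF bounded_bilinear_differentiable[OF cross] mv])
       (rule mom_differentiable[OF u] L linear_differentiable[OF bounded_linear_state_components(4)])+
  have electric: "(\<lambda>v. mom v a p \<bullet> (\<Lambda>1 (position v p) *v k)) differentiable at u within SS" for a p k
    by (rule differentiable_inner[OF mom_differentiable[OF u] mv[OF L(1) differentiable_const]])
  have canonical: "(\<lambda>v. k \<bullet> mom v a p) differentiable at u within SS" for a p k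
    by (rule differentiable_inner[OF differentiable_const mom_differentiable[OF u]])
  have "(\<lambda>v. a \<bullet> (J v *v c)) differentiable at u within SS" for a c
    unfolding poisson_form inner_commute[of "mom _ _ _" "position _ _"]
    by (intro differentiable_add differentiable_diff differentiable_sum differentiable_mult differentiable_const
        finite_UNIV ballI magnetic electric canonical finite_class.finite_UNIV)
  moreover have "J v $ i $ j = axis i 1 \<bullet> (J v *v axis j 1)" for v
    by (simp add: inner_axis' matrix_vector_mult_basis column_def)
  ultimately show "(\<lambda>v. J v $ i $ j) differentiable at u within SS" by simp
qed

section \<open>Generating functions\<close>

text \<open>
  The function \<open>x \<bullet> \<xi> + y \<bullet> \<pi> + s \<bullet> e + t \<bullet> b\<close>, where \<open>y p \<bullet> \<pi>\<^sub>p = \<omega> m (DF(\<xi>\<^sub>p) (y p)) \<bullet> v\<^sub>p\<close>. One formula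
  for all linear combinations of the canonical variables replaces a case distinction over the kinds
  of variables.
\<close>

definition generator ::
    "('p \<Rightarrow> real^3) \<Rightarrow> ('p \<Rightarrow> real^3) \<Rightarrow> real^('n1 \<times> 3) \<Rightarrow> real^('n2 \<times> 3) \<Rightarrow> ('p, 'n1, 'n2) state \<Rightarrow> real" where
  "generator x y s t u =
     (\<Sum>p\<in>UNIV. x p \<bullet> position u p + \<omega> p * m p * ((DF F (position u p) *v y p) \<bullet> velocity u p))
     + s \<bullet> e_coeff u + t \<bullet> b_coeff u"

lemma twice_diff_generator: "twice_diff_on SS (generator x y s t)"
proof -
  have cube: "(\<lambda>u. position u p) ` SS \<subseteq> cube" for p by (auto simp: state_space_def)
  have linear: "twice_diff_on SS (\<lambda>u. k \<bullet> h u)" if "bounded_linear h" for k :: "'z::real_inner" and h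
    using that by (intro twice_diff_on_bounded_linear bounded_linear_inner_right_comp)
  have "twice_diff_on SS (\<lambda>u. \<omega> p * m p * ((DF F (position u p) *v y p) \<bullet> velocity u p))" for p
    by (intro twice_diff_on_bilinear[OF bounded_bilinear_mult] twice_diff_on_const
        twice_diff_on_bilinear[OF bounded_bilinear_inner]
        twice_diff_on_bounded_linear bounded_linear_state_components
        twice_diff_on_linear_compose[OF bounded_linear_state_components(1) cube
          twice_diff_on_smooth[OF smooth_on_DF_mult[OF smooth_F]]])
  then show ?thesis
    unfolding generator_def[abs_def]
    by (intro twice_diff_on_add twice_diff_on_sum linear bounded_linear_state_components)
qed

text \<open>
  The position component is given through its inner products. It contains the second derivative of \<open>F\<close>
  because \<open>\<pi>\<close> depends on \<open>\<xi>\<close>.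
\<close>

lemma gradient_generator:
  assumes u: "u \<in> SS"
  shows "position (gradient SS (generator x y s t) u) p \<bullet> k =
      x p \<bullet> k + \<omega> p * m p * (D2F F (position u p) (y p) k \<bullet> velocity u p)"
    and "velocity (gradient SS (generator x y s t) u) p = (\<omega> p * m p) *\<^sub>R (DF F (position u p) *v y p)"
    and "e_coeff (gradient SS (generator x y s t) u) = s"
    and "b_coeff (gradient SS (generator x y s t) u) = t"
proof -
  \<comment> \<open>Candidate for the gradient, assembled from its four blocks.\<close>
  define r :: "'p \<Rightarrow> real^3"
    where "r p = (\<chi> i. \<omega> p * m p * (D2F F (position u p) (y p) (axis i 1) \<bullet> velocity u p))" for p
  define a :: "('p, 'n1, 'n2) state" where
    "a = (\<chi> i. case i of Inl (p, k) \<Rightarrow> (x p + r p) $ k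
        | Inr (Inl (p, k)) \<Rightarrow> ((\<omega> p * m p) *\<^sub>R (DF F (position u p) *v y p)) $ k
        | Inr (Inr (Inl j)) \<Rightarrow> s $ j | Inr (Inr (Inr j)) \<Rightarrow> t $ j)"
  have comp: "position a p = x p + r p" "velocity a p = (\<omega> p * m p) *\<^sub>R (DF F (position u p) *v y p)"
    "e_coeff a = s" "b_coeff a = t" for p
    by (simp_all add: a_def position_def velocity_def e_coeff_def b_coeff_def vec_eq_iff)
  note D2 = D2F_has_derivative[OF smooth_F position_in_cube[OF u]]
  have r: "r p \<bullet> k = \<omega> p * m p * (D2F F (position u p) (y p) k \<bullet> velocity u p)" for p k
    by (subst linear_eq_sum_axis[OF has_derivative_linear[OF D2]])
       (simp add: r_def inner_vec_def[of "vec_lambda _"] inner_sum_left sum_distrib_left mult_ac)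
  have "((\<lambda>u. generator x y s t u) has_derivative
     (\<lambda>w. (\<Sum>p\<in>UNIV. x p \<bullet> position w p + \<omega> p * m p *
           ((DF F (position u p) *v y p) \<bullet> velocity w p + D2F F (position u p) (y p) (position w p) \<bullet> velocity u p))
        + s \<bullet> e_coeff w + t \<bullet> b_coeff w)) (at u within SS)"
    unfolding generator_def
    by (intro has_derivative_add has_derivative_sum has_derivative_mult_right has_derivative_inner_right
        has_derivative_inner position_has_derivative[OF u D2]
        bounded_linear_imp_has_derivative bounded_linear_state_components)
  note der = gradient_inner[OF axis_accessible_state_space u this]
  have "gradient SS (generator x y s t) u \<bullet> w = a \<bullet> w" for w
    unfolding der inner_state[of a w] comp inner_add_left r
    by (simp add: sum.distrib distrib_left)
  then have "gradient SS (generator x y s t) u = a" using vector_eq_rdot by blast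
  then show "position (gradient SS (generator x y s t) u) p \<bullet> k =
      x p \<bullet> k + \<omega> p * m p * (D2F F (position u p) (y p) k \<bullet> velocity u p)"
    "velocity (gradient SS (generator x y s t) u) p = (\<omega> p * m p) *\<^sub>R (DF F (position u p) *v y p)"
    "e_coeff (gradient SS (generator x y s t) u) = s"
    "b_coeff (gradient SS (generator x y s t) u) = t"
    by (simp_all add: comp inner_add_left r)
qed

lemma mom_gradient_generator:
  assumes u: "u \<in> SS"
  shows "mom u (gradient SS (generator x y s t) u) p = y p"
  using DF_inverse(1)[OF position_in_cube[OF u]]
  by (simp add: mom_def gradient_generator[OF u] transpose_N_F matrix_vector_scaleR_right)

text \<open>
  Invertibility of \<open>DF\<close> lets \<open>y\<close> match any velocity component. Then \<open>x\<close> is chosen to absorb the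
  second derivative of \<open>F\<close> in the position component.
\<close>

lemma gradient_is_generator_gradient:
  assumes u: "u \<in> SS"
  obtains x y s t where "gradient SS (generator x y s t) u = a"
proof -
  define y where "y = mom u a"
  define x where "x p = position a p - (\<chi> i. \<omega> p * m p * (D2F F (position u p) (y p) (axis i 1) \<bullet> velocity u p))" for p
  let ?g = "gradient SS (generator x y (e_coeff a) (b_coeff a)) u"
  have "?g = a"
  proof (rule state_eqI)
    show "position ?g p = position a p" for p
    proof -
      have "position ?g p $ i = position a p $ i" for i
        using gradient_generator(1)[OF u, of x y "e_coeff a" "b_coeff a" p "axis i 1"]
        by (simp add: inner_axis x_def)
      then show ?thesis by (simp add: vec_eq_iff)
    qed
    show "velocity ?g p = velocity a p" for p
      using DF_inverse(2)[OF position_in_cube[OF u], of p]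
      by (simp add: gradient_generator[OF u] y_def mom_def transpose_N_F matrix_vector_scaleR_right)
  qed (simp_all add: gradient_generator[OF u])
  then show thesis by (rule that)
qed

text \<open>
  The terms with the second derivative of \<open>F\<close> cancel by its symmetry. What remains depends on the
  state through \<open>\<xi>\<close> and \<open>b\<close> only.
\<close>

lemma bracket_generators:
  assumes u: "u \<in> SS"
  shows "matrix_bracket SS J (generator x y s t) (generator x' y' s' t') u =
    (\<Sum>p\<in>UNIV. x p \<bullet> y' p - y p \<bullet> x' p) + (C *v (M1_inv *v s)) \<bullet> t' - t \<bullet> (C *v (M1_inv *v s'))
    + (\<Sum>p\<in>UNIV. \<omega> p * q p * (cross3 (y p) (y' p) \<bullet> (\<Lambda>2 (position u p) *v b_coeff u)
        + y p \<bullet> (\<Lambda>1 (position u p) *v (M1_inv *v s'))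
        - y' p \<bullet> (\<Lambda>1 (position u p) *v (M1_inv *v s))))"
proof -
  have pos: "position (gradient SS (generator x y s t) u) p \<bullet> y' p
      - y p \<bullet> position (gradient SS (generator x' y' s' t') u) p = x p \<bullet> y' p - y p \<bullet> x' p" for p
    unfolding inner_commute[of "y p"] gradient_generator(1)[OF u]
    by (simp add: D2F_symmetric[OF smooth_F position_in_cube[OF u], of p "y p" "y' p"])
  show ?thesis
    unfolding matrix_bracket_def poisson_form mom_gradient_generator[OF u] pos
      gradient_generator(3,4)[OF u]
    by (simp add: sum.distrib)
qed

section \<open>The Jacobi identity\<close>

definition D\<Lambda>1 where "D\<Lambda>1 \<xi> = frechet_derivative \<Lambda>1 (at \<xi> within cube)"
definition D\<Lambda>2 where "D\<Lambda>2 \<xi> = frechet_derivative \<Lambda>2 (at \<xi> within cube)"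

lemma \<Lambda>_has_derivative:
  assumes "\<xi> \<in> cube"
  shows "(\<Lambda>1 has_derivative D\<Lambda>1 \<xi>) (at \<xi> within cube)" "(\<Lambda>2 has_derivative D\<Lambda>2 \<xi>) (at \<xi> within cube)"
  using \<Lambda>1_diff \<Lambda>2_diff assms
  by (simp_all add: D\<Lambda>1_def D\<Lambda>2_def differentiable_on_def frechet_derivative_works[symmetric])

text \<open>
  The bracket of two generators is differentiated along the Hamiltonian vector field of the third.
  Only its position component \<open>y''\<close> and its \<open>b\<close> component \<open>- C M\<^sub>1\<inverse> s''\<close> matter, since the function
  depends on nothing else.
\<close>

lemma nested_bracket_generators:
  assumes u: "u \<in> SS"
  shows "matrix_bracket SS J (matrix_bracket SS J (generator x y s t) (generator x' y' s' t')) (generator x'' y'' s'' t'') u =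
    (\<Sum>p\<in>UNIV. \<omega> p * q p * (
        cross3 (y p) (y' p) \<bullet> (D\<Lambda>2 (position u p) (y'' p) *v b_coeff u)
        - cross3 (y p) (y' p) \<bullet> (\<Lambda>2 (position u p) *v (C *v (M1_inv *v s'')))
        + y p \<bullet> (D\<Lambda>1 (position u p) (y'' p) *v (M1_inv *v s'))
        - y' p \<bullet> (D\<Lambda>1 (position u p) (y'' p) *v (M1_inv *v s))))"
proof -
  note L = position_has_derivative[OF u \<Lambda>_has_derivative(1)[OF position_in_cube[OF u]]]
    position_has_derivative[OF u \<Lambda>_has_derivative(2)[OF position_in_cube[OF u]]]
  have "((\<lambda>u. (\<Sum>p\<in>UNIV. x p \<bullet> y' p - y p \<bullet> x' p) + (C *v (M1_inv *v s)) \<bullet> t' - t \<bullet> (C *v (M1_inv *v s'))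
    + (\<Sum>p\<in>UNIV. \<omega> p * q p * (cross3 (y p) (y' p) \<bullet> (\<Lambda>2 (position u p) *v b_coeff u)
        + y p \<bullet> (\<Lambda>1 (position u p) *v (M1_inv *v s'))
        - y' p \<bullet> (\<Lambda>1 (position u p) *v (M1_inv *v s))))) has_derivative
    (\<lambda>w. 0 + (\<Sum>p\<in>UNIV. \<omega> p * q p * (cross3 (y p) (y' p) \<bullet>
          (\<Lambda>2 (position u p) *v b_coeff w + D\<Lambda>2 (position u p) (position w p) *v b_coeff u)
        + y p \<bullet> (\<Lambda>1 (position u p) *v 0 + D\<Lambda>1 (position u p) (position w p) *v (M1_inv *v s'))
        - y' p \<bullet> (\<Lambda>1 (position u p) *v 0 + D\<Lambda>1 (position u p) (position w p) *v (M1_inv *v s))))))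
    (at u within SS)"
    by (intro has_derivative_add has_derivative_diff has_derivative_const has_derivative_sum
        has_derivative_mult_right has_derivative_inner_right matrix_vector_has_derivative L
        bounded_linear_imp_has_derivative bounded_linear_state_components)
  then have "(matrix_bracket SS J (generator x y s t) (generator x' y' s' t') has_derivative
    (\<lambda>w. 0 + (\<Sum>p\<in>UNIV. \<omega> p * q p * (cross3 (y p) (y' p) \<bullet>
          (\<Lambda>2 (position u p) *v b_coeff w + D\<Lambda>2 (position u p) (position w p) *v b_coeff u)
        + y p \<bullet> (\<Lambda>1 (position u p) *v 0 + D\<Lambda>1 (position u p) (position w p) *v (M1_inv *v s'))
        - y' p \<bullet> (\<Lambda>1 (position u p) *v 0 + D\<Lambda>1 (position u p) (position w p) *v (M1_inv *v s))))))
    (at u within SS)"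
    by (rule has_derivative_transform[OF u, rotated]) (rule bracket_generators)
  note der = gradient_inner[OF axis_accessible_state_space u this]
  show ?thesis
    unfolding matrix_bracket_def[of _ _ _ "generator x'' y'' s'' t''"] der
    by (simp add: poisson_components mom_gradient_generator[OF u] gradient_generator[OF u]
        matrix_vector_minus_right inner_add_right inner_minus_right algebra_simps)
qed

text \<open>
  The cyclic sum vanishes particle by particle: the terms with \<open>b\<close> by the divergence relation and the
  Gauss law, and those with \<open>s\<close>, \<open>s'\<close>, \<open>s''\<close> in three pairs by the curl relation.
\<close>

lemma jacobi_generators:
  assumes u: "u \<in> SS"
    and div: "\<And>\<xi> j. \<xi> \<in> cube \<Longrightarrow> divergence cube (\<lambda>\<eta>. column j (\<Lambda>2 \<eta>)) \<xi> = (R \<xi>) $ 1 $ j"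
    and gauss: "\<And>\<xi>. \<xi> \<in> cube \<Longrightarrow> R \<xi> *v b_coeff u = (0 :: real^1)"
  shows "jacobiator (matrix_bracket SS J) (generator x y s t) (generator x' y' s' t') (generator x'' y'' s'' t'') u = 0"
proof -
  have zero: "cross3 y y' \<bullet> (D\<Lambda>2 \<xi> y'' *v b_coeff u) - cross3 y y' \<bullet> (\<Lambda>2 \<xi> *v (C *v c''))
        + y \<bullet> (D\<Lambda>1 \<xi> y'' *v c') - y' \<bullet> (D\<Lambda>1 \<xi> y'' *v c)
      + (cross3 y' y'' \<bullet> (D\<Lambda>2 \<xi> y *v b_coeff u) - cross3 y' y'' \<bullet> (\<Lambda>2 \<xi> *v (C *v c))
        + y' \<bullet> (D\<Lambda>1 \<xi> y *v c'') - y'' \<bullet> (D\<Lambda>1 \<xi> y *v c'))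
      + (cross3 y'' y \<bullet> (D\<Lambda>2 \<xi> y' *v b_coeff u) - cross3 y'' y \<bullet> (\<Lambda>2 \<xi> *v (C *v c'))
        + y'' \<bullet> (D\<Lambda>1 \<xi> y' *v c) - y \<bullet> (D\<Lambda>1 \<xi> y' *v c'')) = 0"
    if \<xi>: "\<xi> \<in> cube" for \<xi> y y' y'' c c' c''
  proof -
    note curl = curl_relation_contracted[OF \<Lambda>_has_derivative(1)[OF \<xi>] \<xi> curl_\<Lambda>1[OF \<xi>]]
    show ?thesis
      using divergence_relation_contracted[OF \<Lambda>_has_derivative(2)[OF \<xi>] \<xi> div[OF \<xi>], of y y' y'' "b_coeff u"]
        curl[of y' y c''] curl[of y'' y' c] curl[of y y'' c'] gauss[OF \<xi>]
        cross_skew[of y y'] cross_skew[of y' y''] cross_skew[of y'' y]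
      by (simp add: matrix_vector_mul_assoc)
  qed
  show ?thesis
    unfolding jacobiator_def nested_bracket_generators[OF u] sum.distrib[symmetric] distrib_left[symmetric]
      zero[OF position_in_cube[OF u]]
    by simp
qed

lemma jacobi:
  assumes u: "u \<in> SS"
    and fgh: "twice_diff_on SS f" "twice_diff_on SS g" "twice_diff_on SS h"
    and div: "\<And>\<xi> j. \<xi> \<in> cube \<Longrightarrow> divergence cube (\<lambda>\<eta>. column j (\<Lambda>2 \<eta>)) \<xi> = (R \<xi>) $ 1 $ j"
    and gauss: "\<And>\<xi>. \<xi> \<in> cube \<Longrightarrow> R \<xi> *v b_coeff u = (0 :: real^1)"
  shows "jacobiator (matrix_bracket SS J) f g h u = 0"
proof -
  obtain J' where J': "(J has_derivative J') (at u within SS)"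
    using poisson_differentiable[OF u] unfolding differentiable_def by blast
  obtain x y s t where f: "gradient SS (generator x y s t) u = gradient SS f u"
    by (rule gradient_is_generator_gradient[OF u])
  obtain x' y' s' t' where g: "gradient SS (generator x' y' s' t') u = gradient SS g u"
    by (rule gradient_is_generator_gradient[OF u])
  obtain x'' y'' s'' t'' where h: "gradient SS (generator x'' y'' s'' t'') u = gradient SS h u"
    by (rule gradient_is_generator_gradient[OF u])
  note tensorial = jacobiator_tensorial[OF axis_accessible_state_space u poisson_antisymmetric J']
  have "jacobiator (matrix_bracket SS J) f g h u =
      jacobiator (matrix_bracket SS J) (generator x y s t) (generator x' y' s' t') (generator x'' y'' s'' t'') u"
    unfolding tensorial[OF fgh]
      tensorial[OF twice_diff_generator twice_diff_generator twice_diff_generator] f g h ..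
  also have "\<dots> = 0" by (rule jacobi_generators[OF u div gauss])
  finally show ?thesis .
qed

end

theorem theorem4p3:
  fixes F :: "real^3 \<Rightarrow> real^3" and \<Omega> :: "(real^3) set"
    and \<Lambda>0 :: "real^3 \<Rightarrow> real^('n0::finite)^1"
    and \<Lambda>1 :: "real^3 \<Rightarrow> real^('n1::finite \<times> 3)^3"
    and \<Lambda>2 :: "real^3 \<Rightarrow> real^('n2::finite \<times> 3)^3"
    and \<Lambda>3 :: "real^3 \<Rightarrow> real^('n3::finite)^1"
    and G :: "real^'n0^('n1 \<times> 3)"
    and C :: "real^('n1 \<times> 3)^('n2 \<times> 3)"
    and D :: "real^('n2 \<times> 3)^'n3"
    and \<omega> m q :: "'p::finite \<Rightarrow> real"
  assumes "smooth_on cube F" and "bij_betw F cube \<Omega>"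
    and "\<And>\<xi>. \<xi> \<in> cube \<Longrightarrow> J_F F \<xi> \<noteq> 0"
    and "discrete_de_Rham \<Lambda>0 \<Lambda>1 \<Lambda>2 \<Lambda>3 G C D"
    and "symmetric_positive_definite (mass_1 F \<Lambda>1)"
    and "\<And>p. \<omega> p > 0" and "\<And>p. m p > 0" and "\<And>p. q p \<noteq> 0"
  shows "poisson_bracket_on state_space {u. D *v b_coeff u = 0} (bracket F \<Lambda>1 \<Lambda>2 C \<omega> m q)"
proof -
  interpret particle_field_bracket F \<Lambda>1 \<Lambda>2 C \<omega> m q
    using assms unfolding discrete_de_Rham_def by unfold_locales auto
  have br: "bracket F \<Lambda>1 \<Lambda>2 C \<omega> m q = matrix_bracket SS J"
    by (simp add: fun_eq_iff bracket_def matrix_bracket_def J_def)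
  have div: "divergence cube (\<lambda>\<eta>. column j (\<Lambda>2 \<eta>)) \<xi> = (\<Lambda>3 \<xi> ** D) $ 1 $ j" if "\<xi> \<in> cube" for \<xi> j
    using assms(4) that unfolding discrete_de_Rham_def by blast
  have diff: "f differentiable at u within SS" if "smooth_on SS f" "u \<in> SS" for f :: "('p, 'n1, 'n2) state \<Rightarrow> real" and u
    using twice_diff_onE[OF twice_diff_on_smooth[OF that(1)]] that(2) by (metis differentiableI)
  show ?thesis
    unfolding poisson_bracket_on_def br
  proof (intro allI impI conjI ballI)
    fix f g h :: "('p, 'n1, 'n2) state \<Rightarrow> real"
    assume f: "smooth_on SS f" and g: "smooth_on SS g" and h: "smooth_on SS h"
    fix u :: "('p, 'n1, 'n2) state"
    {
      assume u: "u \<in> SS"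
      note combination = gradient_linear_combination[OF axis_accessible_state_space u diff[OF f u] diff[OF g u]]
      note product = gradient_mult[OF axis_accessible_state_space u diff[OF f u] diff[OF g u]]
      note bilinear = matrix_vector_right_distrib matrix_vector_scaleR_right
      show "matrix_bracket SS J (\<lambda>x. \<alpha> * f x + \<beta> * g x) h u
          = \<alpha> * matrix_bracket SS J f h u + \<beta> * matrix_bracket SS J g h u" for \<alpha> \<beta>
        by (simp add: matrix_bracket_def combination inner_add_left)
      show "matrix_bracket SS J h (\<lambda>x. \<alpha> * f x + \<beta> * g x) u
          = \<alpha> * matrix_bracket SS J h f u + \<beta> * matrix_bracket SS J h g u" for \<alpha> \<beta>
        by (simp add: matrix_bracket_def combination bilinear inner_add_right)
      show "matrix_bracket SS J f g u = - matrix_bracket SS J g f u"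
        unfolding matrix_bracket_def by (rule poisson_antisymmetric)
      show "matrix_bracket SS J (\<lambda>x. f x * g x) h u
          = f u * matrix_bracket SS J g h u + matrix_bracket SS J f h u * g u"
        by (simp add: matrix_bracket_def product inner_add_left)
      show "matrix_bracket SS J h (\<lambda>x. f x * g x) u
          = f u * matrix_bracket SS J h g u + matrix_bracket SS J h f u * g u"
        by (simp add: matrix_bracket_def product bilinear inner_add_right)
    }
    assume u: "u \<in> SS \<inter> {u. D *v b_coeff u = 0}"
    have "(\<Lambda>3 \<xi> ** D) *v b_coeff u = 0" for \<xi>
      using u by (simp add: matrix_vector_mul_assoc[symmetric])
    with u have "jacobiator (matrix_bracket SS J) f g h u = 0"
      by (intro jacobi[where R = "\<lambda>\<xi>. \<Lambda>3 \<xi> ** D"] twice_diff_on_smooth f g h div) auto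
    then show "matrix_bracket SS J (matrix_bracket SS J f g) h u +
        matrix_bracket SS J (matrix_bracket SS J g h) f u + matrix_bracket SS J (matrix_bracket SS J h f) g u = 0"
      by (simp add: jacobiator_def)
  qed
qed

end
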